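(* Let $f$ be a $C^\infty$ orientation-preserving diffeomorphism of $[0,1]$ with vanishing asymptotic variation, i.e. $\mathrm{V}_\infty(f)=0$. Then $L_\infty(f)=0$.
   Context: Asymptotic variation: for $f\in \mathrm{Diff}^\infty_+([0,1])$, $\mathrm{V}_\infty(f)=\lim_{n\to+\infty}\frac1n\mathrm{Var}(\log Df^n)$, where $\mathrm{Var}$ denotes the total variation of a function on $[0,1]$ (the limit exists by subadditivity). For an orientation-preserving $C^3$ diffeomorphism $f$ of $[0,1]$, the formula $$c(f)(x,y)=\frac{Df(x)\,Df(y)}{(f(x)-f(y))^2}-\frac{1}{(x-y)^2}$$ defines an $L^1$ function on $[0,1]^2$. Put $L(f)=\|c(f)\|_{L^1([0,1]^2)}$. The map $L$ satisfies $L(fg)\le L(f)+L(g)$, and $L_\infty(f)=\lim_{n\to\infty}L(f^n)/n$. *)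

theory Defs
  imports "HOL-Analysis.Analysis"
begin

text \<open>
  A map of \<open>[0,1]\<close> is represented by a function \<open>real \<Rightarrow> real\<close> of which only the values on
  \<open>{0..1}\<close> matter; hence iterates are given by \<open>f ^^ n\<close>, and derivatives are taken within
  \<open>{0..1}\<close>, i.e. they are one-sided at the endpoints.
\<close>

definition D01 :: "(real \<Rightarrow> real) \<Rightarrow> real \<Rightarrow> real" where
  "D01 f x = vector_derivative f (at x within {0..1})"

definition smooth01 :: "(real \<Rightarrow> real) \<Rightarrow> bool" where
  "smooth01 f \<longleftrightarrow> (\<forall>k. (D01 ^^ k) f differentiable_on {0..1})"

text \<open>The group \<open>Diff\<^sup>\<infinity>\<^sub>+([0,1])\<close>.\<close>

definition smooth_diffeo01 :: "(real \<Rightarrow> real) \<Rightarrow> bool" where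
  "smooth_diffeo01 f \<longleftrightarrow>
     bij_betw f {0..1} {0..1} \<and> smooth01 f \<and> smooth01 (inv_into {0..1} f) \<and>
     strict_mono_on {0..1} f"

definition total_variation01 :: "(real \<Rightarrow> real) \<Rightarrow> ennreal" where
  "total_variation01 u =
     (SUP (n, t) \<in> {(n :: nat, t :: nat \<Rightarrow> real). mono_on {..n} t \<and> t ` {..n} \<subseteq> {0..1}}.
        \<Sum>i<n. ennreal \<bar>u (t (Suc i)) - u (t i)\<bar>)"

text \<open>
  The two limits below exist for diffeomorphisms, by subadditivity. If there were no limit,
  \<^const>\<open>lim\<close> would be an unspecified value, about which nothing can be proved.
  Both sequences are taken in \<^typ>\<open>ennreal\<close>, so that an infinite variation or \<open>L\<^sup>1\<close> norm
  is not silently replaced by a real number.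
\<close>

definition V_infty :: "(real \<Rightarrow> real) \<Rightarrow> ennreal" where
  "V_infty f = lim (\<lambda>n. total_variation01 (\<lambda>x. ln (D01 (f ^^ n) x)) / of_nat n)"

text \<open>
  On the diagonal, division by zero yields 0; this set is negligible for the \<open>L\<^sup>1\<close> norm.
\<close>

definition c_kernel :: "(real \<Rightarrow> real) \<Rightarrow> real \<times> real \<Rightarrow> real" where
  "c_kernel f = (\<lambda>(x, y). D01 f x * D01 f y / (f x - f y)\<^sup>2 - 1 / (x - y)\<^sup>2)"

definition L_norm :: "(real \<Rightarrow> real) \<Rightarrow> ennreal" where
  "L_norm f = (\<integral>\<^sup>+ p \<in> {0..1} \<times> {0..1}. ennreal \<bar>c_kernel f p\<bar> \<partial>lborel)"

definition L_infty :: "(real \<Rightarrow> real) \<Rightarrow> ennreal" where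
  "L_infty f = lim (\<lambda>n. L_norm (f ^^ n) / of_nat n)"

end

(*
  Write k j (x, y) = Df^j(x) Df^j(y) / (f^j(x) - f^j(y))^2 for an integer j, so that c(f^n) = k n - k 0.
  Off the pairs of fixed points, f x f acts dissipatively; unfolding the L^1 norm along orbits turns
  L(f^n) / n into the integral over a (weighted) fundamental domain of
  (1/n) * sum over j of |k (j + n) - k j|, which tends to |k(+infinity) - k(-infinity)|.
  It remains to see that k has the same limit at both ends of almost every orbit.

  For two points x, u of one component of the complement of the fixed point set, log Df^j(u) - log Df^j(x)
  has limits as j tends to +infinity and -infinity, and the variation of log Df^n is at least about n times
  the difference of these limits (sum over the translates of the interval [x, u]). So vanishing asymptotic
  variation makes the two limits equal. With u = f(x) this gives Df = 1 at all fixed points. Moreover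
  1 / k j (x, y) is the product of the integrals over [x, y] of Df^j / Df^j(x) and Df^j / Df^j(y), whence the equality of
  the limits of k for pairs in one component. For other pairs both limits are 0, as Df^j(x) / |f^j(x) - q|
  tends to 0 for every fixed point q.
*)

theory Submission
  imports Defs
begin

section \<open>Sequences and total variation\<close>

text \<open>The passage to the limit rests on the case n = 1. The sum over j of |k (j + 1) - k j|,
  integrated over the weighted fundamental domain, is at most L(f), which is finite because c(f) is
  bounded. So this sum is finite for almost every pair. That gives the existence of both limits of
  k, and the triangle inequality makes the same sum a dominating function for the averages of all n.

  Pairs (x, y) with y the limit of the orbit of x have to be avoided: Df^j(x) / (f^j(x) - y)^2 need
  not tend to 0 for them. They lie on the graphs of two measurable functions, hence in a null set.
  Pairs of fixed points, in contrast, may have positive measure; no orbit unfolds them, but c(f^n)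
  vanishes there because Df = 1 at both points.

  The hypothesis is an equation about \<open>lim\<close>, which says something about the sequence
  only once convergence is known; hence the detour through subadditivity. The conclusion is obtained
  as convergence to 0.\<close>

lemma nn_integral_count_space_shift:
  fixes g :: "int \<Rightarrow> ennreal"
  shows "(\<integral>\<^sup>+j. g (j + n) \<partial>count_space UNIV) = (\<integral>\<^sup>+j. g j \<partial>count_space UNIV)"
  by (rule nn_integral_bij_count_space)
     (auto simp: bij_betw_def inj_on_def surj_def intro: exI[of _ "_ - n"])

text \<open>A shift by n consists of n shifts by 1, and each contributes the same sum because the
  counting measure is invariant. After division by n the bound is independent of n, as dominated
  convergence will require.\<close>

lemma shift_sum_le:
  fixes b :: "int \<Rightarrow> real"
  shows "(\<integral>\<^sup>+j. ennreal \<bar>b (j + int n) - b j\<bar> \<partial>count_space UNIV)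
     \<le> of_nat n * (\<integral>\<^sup>+j. ennreal \<bar>b (j + 1) - b j\<bar> \<partial>count_space UNIV)"
proof (induction n)
  case (Suc n)
  have "(\<integral>\<^sup>+j. ennreal \<bar>b (j + int (Suc n)) - b j\<bar> \<partial>count_space UNIV)
     \<le> (\<integral>\<^sup>+j. ennreal \<bar>b (j + int n) - b j\<bar> + ennreal \<bar>b ((j + int n) + 1) - b (j + int n)\<bar> \<partial>count_space UNIV)"
    by (intro nn_integral_mono) (auto simp flip: ennreal_plus simp: ac_simps intro!: ennreal_leI)
  also have "\<dots> = (\<integral>\<^sup>+j. ennreal \<bar>b (j + int n) - b j\<bar> \<partial>count_space UNIV)
      + (\<integral>\<^sup>+j. ennreal \<bar>b (j + 1) - b j\<bar> \<partial>count_space UNIV)"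
    using nn_integral_count_space_shift[of "\<lambda>j. ennreal \<bar>b (j + 1) - b j\<bar>" "int n"]
    by (subst nn_integral_add) auto
  also have "\<dots> \<le> of_nat (Suc n) * (\<integral>\<^sup>+j. ennreal \<bar>b (j + 1) - b j\<bar> \<partial>count_space UNIV)"
    using Suc.IH by (simp add: distrib_right add.commute add_mono)
  finally show ?case .
qed simp

lemma convergent_int_at_top:
  fixes b :: "int \<Rightarrow> real"
  assumes "(\<integral>\<^sup>+j. ennreal \<bar>b (j + 1) - b j\<bar> \<partial>count_space UNIV) < \<infinity>"
  shows "convergent (\<lambda>n. b (int n))"
proof -
  have "(\<integral>\<^sup>+n. ennreal \<bar>b (int n + 1) - b (int n)\<bar> \<partial>count_space UNIV)
      = (\<integral>\<^sup>+j. ennreal \<bar>b (j + 1) - b j\<bar> \<partial>count_space (range int))"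
    by (rule nn_integral_bij_count_space) (auto simp: bij_betw_def)
  also have "\<dots> \<le> (\<integral>\<^sup>+j. ennreal \<bar>b (j + 1) - b j\<bar> \<partial>count_space UNIV)"
    by (subst nn_integral_count_space_indicator) (auto intro!: nn_integral_mono split: split_indicator)
  finally have "(\<integral>\<^sup>+n. ennreal \<bar>b (int n + 1) - b (int n)\<bar> \<partial>count_space UNIV) < \<infinity>"
    using assms by (rule le_less_trans)
  then have "(\<Sum>n. ennreal \<bar>b (int n + 1) - b (int n)\<bar>) \<noteq> \<infinity>"
    by (simp add: nn_integral_count_space_nat)
  then have "summable (\<lambda>n. \<bar>b (int n + 1) - b (int n)\<bar>)"
    by (intro summable_suminf_not_top) auto
  then have "summable (\<lambda>n. b (int n + 1) - b (int n))"
    by (rule summable_rabs_cancel)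
  then obtain l where "(\<lambda>n. b (int n + 1) - b (int n)) sums l"
    by (auto simp: summable_def)
  then have "(\<lambda>n. \<Sum>i<n. b (int i + 1) - b (int i)) \<longlonglongrightarrow> l"
    by (simp add: sums_def)
  moreover have "(\<Sum>i<n. b (int i + 1) - b (int i)) = b (int n) - b 0" for n
    by (induction n) (auto simp: ac_simps)
  ultimately have "(\<lambda>n. b (int n) - b 0) \<longlonglongrightarrow> l" by simp
  then have "(\<lambda>n. (b (int n) - b 0) + b 0) \<longlonglongrightarrow> l + b 0"
    by (intro tendsto_intros)
  then show ?thesis by (auto simp: convergent_def)
qed

text \<open>Let c be the common limit at both ends. Then b - c splits into a finitely supported part
  \<open>z\<close> and a remainder \<open>r\<close> of variation at most 3e. The shift sum of
  \<open>r\<close> is at most 3en, that of \<open>z\<close> is at most 2Z whatever n is, so dividing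
  by n leaves at most 4e for large n.\<close>

lemma shift_sum_tendsto_0:
  fixes b :: "int \<Rightarrow> real"
  assumes fin: "(\<integral>\<^sup>+j. ennreal \<bar>b (j + 1) - b j\<bar> \<partial>count_space UNIV) < \<infinity>"
    and lim: "(\<lambda>n. b (int n) - b (- int n)) \<longlonglongrightarrow> 0"
  shows "(\<lambda>n. (\<integral>\<^sup>+j. ennreal \<bar>b (j + int n) - b j\<bar> \<partial>count_space UNIV) / of_nat n) \<longlonglongrightarrow> 0"
proof -
  obtain c where c: "(\<lambda>n. b (int n)) \<longlonglongrightarrow> c"
    using convergent_int_at_top[OF fin] by (auto simp: convergent_def)
  have c': "(\<lambda>n. b (- int n)) \<longlonglongrightarrow> c"
    using tendsto_diff[OF c lim] by simp
  define a where "a = (\<lambda>j. ennreal \<bar>b (j + 1) - b j\<bar>)"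
  have tail: "(\<lambda>m. \<integral>\<^sup>+j. a j * indicator (- {-int m..int m}) j \<partial>count_space UNIV) \<longlonglongrightarrow> (\<integral>\<^sup>+j. 0 \<partial>count_space (UNIV::int set))"
  proof (rule nn_integral_dominated_convergence[where w = a])
    show "AE j in count_space UNIV. (\<lambda>m. a j * indicator (- {-int m..int m}) j) \<longlonglongrightarrow> 0"
    proof (rule AE_I2)
      fix j :: int
      have "\<forall>\<^sub>F m in sequentially. a j * indicator (- {-int m..int m}) j = 0"
        using eventually_ge_at_top[of "nat \<bar>j\<bar>"] by eventually_elim (auto simp: indicator_def)
      then show "(\<lambda>m. a j * indicator (- {-int m..int m}) j) \<longlonglongrightarrow> 0"
        by (rule tendsto_eventually)
    qed
  qed (use fin in \<open>auto simp: a_def indicator_def\<close>)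
  have main: "\<forall>\<^sub>F n in sequentially. (\<integral>\<^sup>+j. ennreal \<bar>b (j + int n) - b j\<bar> \<partial>count_space UNIV) / of_nat n \<le> ennreal (4 * e)"
    if e: "e > 0" for e :: real
  proof -
    have "\<forall>\<^sub>F m in sequentially. (\<integral>\<^sup>+j. a j * indicator (- {-int m..int m}) j \<partial>count_space UNIV) < ennreal e"
      using tail e by (intro order_tendstoD(2)[where y=0]) auto
    moreover have "\<forall>\<^sub>F m in sequentially. \<bar>b (int (Suc m)) - c\<bar> < e"
      using c[THEN LIMSEQ_Suc, THEN tendstoD, OF e] by (simp add: dist_real_def)
    moreover have "\<forall>\<^sub>F m in sequentially. \<bar>b (- int (Suc m)) - c\<bar> < e"
      using c'[THEN LIMSEQ_Suc, THEN tendstoD, OF e] by (simp add: dist_real_def)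
    ultimately have "\<forall>\<^sub>F m in sequentially. (\<integral>\<^sup>+j. a j * indicator (- {-int m..int m}) j \<partial>count_space UNIV) < ennreal e
       \<and> \<bar>b (int (Suc m)) - c\<bar> < e \<and> \<bar>b (- int (Suc m)) - c\<bar> < e"
      by eventually_elim auto
    then obtain m where m: "(\<integral>\<^sup>+j. a j * indicator (- {-int m..int m}) j \<partial>count_space UNIV) < ennreal e"
       "\<bar>b (int (Suc m)) - c\<bar> < e" "\<bar>b (- int (Suc m)) - c\<bar> < e"
      by (auto simp: eventually_sequentially)
    define z where "z = (\<lambda>j::int. if j \<in> {-int m..int m} then b j - c else 0)"
    define r where "r = (\<lambda>j::int. if j \<in> {-int m..int m} then 0 else b j - c)"
    have zfin: "(\<integral>\<^sup>+j. ennreal \<bar>z j\<bar> \<partial>count_space UNIV) < \<infinity>"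
    proof -
      have "(\<integral>\<^sup>+j. ennreal \<bar>z j\<bar> \<partial>count_space UNIV) = (\<Sum>j\<in>{-int m..int m}. ennreal \<bar>z j\<bar>)"
        by (rule nn_integral_count_space') (auto simp: z_def)
      then show ?thesis by simp
    qed
    \<comment> \<open>Cutting out the window creates two jumps, at j = m and at j = -m-1, of heights
      |b (m+1) - c| and |b (-m-1) - c|. Together with the tail of the variation of b this makes
      three terms of size e.\<close>
    have "(\<integral>\<^sup>+j. ennreal \<bar>r (j + 1) - r j\<bar> \<partial>count_space UNIV)
       \<le> (\<integral>\<^sup>+j. (a j * indicator (- {-int m..int m}) j + ennreal e * indicator {int m} j)
              + ennreal e * indicator {- int m - 1} j \<partial>count_space UNIV)"
    proof (rule nn_integral_mono)
      fix j :: int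
      consider "j = int m" | "j = - int m - 1" | "j \<in> {-int m..<int m}" | "j > int m \<or> j < - int m - 1"
        by fastforce
      then show "ennreal \<bar>r (j + 1) - r j\<bar> \<le> (a j * indicator (- {-int m..int m}) j + ennreal e * indicator {int m} j)
              + ennreal e * indicator {- int m - 1} j"
      proof cases
        case 1
        then have "\<bar>r (j + 1) - r j\<bar> = \<bar>b (int (Suc m)) - c\<bar>" by (simp add: r_def add.commute)
        then have "ennreal \<bar>r (j + 1) - r j\<bar> \<le> ennreal e" using m(2) by (simp add: ennreal_leI)
        then show ?thesis using 1 by simp
      next
        case 2
        then have "j = - int (Suc m)" by simp
        then have "\<bar>r (j + 1) - r j\<bar> = \<bar>b (- int (Suc m)) - c\<bar>" by (simp add: r_def)
        then have "ennreal \<bar>r (j + 1) - r j\<bar> \<le> ennreal e" using m(3) by (simp add: ennreal_leI)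
        then show ?thesis using 2 by (simp add: add_increasing)
      next
        case 3
        then show ?thesis by (auto simp: r_def)
      next
        case 4
        then have "\<bar>r (j + 1) - r j\<bar> = \<bar>b (j+1) - b j\<bar>" by (auto simp: r_def)
        then show ?thesis using 4 by (auto simp: a_def indicator_def)
      qed
    qed
    also have "\<dots> = (\<integral>\<^sup>+j. a j * indicator (- {-int m..int m}) j \<partial>count_space UNIV) + ennreal e + ennreal e"
      by (simp add: nn_integral_add nn_integral_cmult)
    also have "\<dots> \<le> ennreal e + ennreal e + ennreal e"
      using m(1) by (intro add_mono) auto
    finally have r3: "(\<integral>\<^sup>+j. ennreal \<bar>r (j + 1) - r j\<bar> \<partial>count_space UNIV) \<le> ennreal (3 * e)"
      using e by (simp flip: ennreal_plus)
    obtain Z where Z: "(\<integral>\<^sup>+j. ennreal \<bar>z j\<bar> \<partial>count_space UNIV) = ennreal Z" "Z \<ge> 0"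
      using zfin by (cases "\<integral>\<^sup>+j. ennreal \<bar>z j\<bar> \<partial>count_space UNIV") auto
    have bound: "(\<integral>\<^sup>+j. ennreal \<bar>b (j + int n) - b j\<bar> \<partial>count_space UNIV) \<le> ennreal (real n * (3 * e) + 2 * Z)" for n
    proof -
      have "(\<integral>\<^sup>+j. ennreal \<bar>b (j + int n) - b j\<bar> \<partial>count_space UNIV)
        \<le> (\<integral>\<^sup>+j. (ennreal \<bar>r (j + int n) - r j\<bar> + ennreal \<bar>z (j + int n)\<bar>) + ennreal \<bar>z j\<bar> \<partial>count_space UNIV)"
      proof (rule nn_integral_mono)
        fix j :: int
        have "b j = r j + z j + c" for j by (auto simp: r_def z_def)
        then have "\<bar>b (j + int n) - b j\<bar> \<le> \<bar>r (j + int n) - r j\<bar> + \<bar>z (j + int n)\<bar> + \<bar>z j\<bar>"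
          using abs_triangle_ineq4[of "r (j + int n) - r j + z (j + int n)" "z j"]
            abs_triangle_ineq[of "r (j + int n) - r j" "z (j + int n)"] by (simp add: algebra_simps)
        then show "ennreal \<bar>b (j + int n) - b j\<bar> \<le> (ennreal \<bar>r (j + int n) - r j\<bar> + ennreal \<bar>z (j + int n)\<bar>) + ennreal \<bar>z j\<bar>"
          by (simp flip: ennreal_plus add: ennreal_leI)
      qed
      also have "\<dots> = (\<integral>\<^sup>+j. ennreal \<bar>r (j + int n) - r j\<bar> \<partial>count_space UNIV)
         + (\<integral>\<^sup>+j. ennreal \<bar>z (j + int n)\<bar> \<partial>count_space UNIV) + (\<integral>\<^sup>+j. ennreal \<bar>z j\<bar> \<partial>count_space UNIV)"
        by (simp add: nn_integral_add)
      also have "\<dots> = (\<integral>\<^sup>+j. ennreal \<bar>r (j + int n) - r j\<bar> \<partial>count_space UNIV) + ennreal Z + ennreal Z"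
        using nn_integral_count_space_shift[of "\<lambda>j. ennreal \<bar>z j\<bar>" "int n"] Z by simp
      also have "\<dots> \<le> of_nat n * ennreal (3 * e) + ennreal Z + ennreal Z"
        by (intro add_mono order_trans[OF shift_sum_le] mult_left_mono r3) auto
      also have "\<dots> = ennreal (real n * (3 * e) + 2 * Z)"
        using e Z by (simp flip: ennreal_plus ennreal_mult' add: ennreal_of_nat_eq_real_of_nat)
      finally show ?thesis .
    qed
    have "\<forall>\<^sub>F n in sequentially. n > nat \<lceil>2 * Z / e\<rceil>" by (rule eventually_gt_at_top)
    then show ?thesis
    proof eventually_elim
      case (elim n)
      then have "2 * Z / e < real n" using real_nat_ceiling_ge[of "2 * Z / e"] by linarith
      then have n: "2 * Z \<le> e * real n" "n > 0"
        using e elim by (auto simp: field_simps)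
      have "(\<integral>\<^sup>+j. ennreal \<bar>b (j + int n) - b j\<bar> \<partial>count_space UNIV) / of_nat n \<le> ennreal (real n * (3 * e) + 2 * Z) / of_nat n"
        by (intro divide_right_mono_ennreal bound)
      also have "\<dots> = ennreal ((real n * (3 * e) + 2 * Z) / real n)"
        using n e Z by (simp add: ennreal_of_nat_eq_real_of_nat divide_ennreal del: ennreal_plus)
      also have "\<dots> \<le> ennreal (4 * e)"
        using n by (intro ennreal_leI) (simp add: field_simps)
      finally show ?case .
    qed
  qed
  show ?thesis
  proof (rule order_tendstoI)
    fix x :: ennreal assume "0 < x"
    then obtain e where e: "0 < e" "e < x" using dense by blast
    then obtain e' where e': "e = ennreal e'" "e' > 0"
      by (cases e) (auto simp: ennreal_less_zero_iff)
    show "\<forall>\<^sub>F n in sequentially. (\<integral>\<^sup>+j. ennreal \<bar>b (j + int n) - b j\<bar> \<partial>count_space UNIV) / of_nat n < x"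
      using main[of "e'/4"] e' by (auto elim!: eventually_mono intro: le_less_trans[OF _ e(2)])
  qed auto
qed

section \<open>Subadditive sequences\<close>

lemma Fekete_convergent:
  fixes v :: "nat \<Rightarrow> real"
  assumes sub: "\<And>m n. v (m + n) \<le> v m + v n" and nonneg: "\<And>n. v n \<ge> 0"
  shows "convergent (\<lambda>n. v n / real n)"
proof -
  \<comment> \<open>The index 0 is left out since \<open>v 0 / 0\<close> is 0, which would make the
    infimum 0.\<close>
  define L where "L = (INF n\<in>{1..}. v n / real n)"
  have bdd: "bdd_below ((\<lambda>n. v n / real n) ` {1..})"
    by (rule bdd_belowI2[of _ 0]) (simp add: nonneg)
  have lower: "L \<le> v n / real n" if "n \<ge> 1" for n
    unfolding L_def by (rule cINF_lower[OF bdd]) (use that in auto)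
  have mult: "v (q * m) \<le> real q * v m + v 0" for q m
  proof (induction q)
    case (Suc q)
    have "v (Suc q * m) \<le> v m + v (q * m)" using sub[of m "q*m"] by simp
    with Suc show ?case by (simp add: algebra_simps)
  qed simp
  have upper: "\<forall>\<^sub>F n in sequentially. v n / real n < L + e" if e: "e > 0" for e
  proof -
    have "\<exists>n\<in>{1..}. v n / real n < L + e/2"
      using cINF_less_iff[OF _ bdd, of "L + e/2"] e by (auto simp: L_def)
    then obtain m where m: "m \<ge> 1" "v m / real m < L + e/2" by auto
    define B where "B = (\<Sum>r<m. v r) + v 0"
    have "B \<ge> 0" by (simp add: B_def nonneg sum_nonneg)
    have v: "v n \<le> real n * (v m / real m) + B" for n
    proof -
      have "v n = v (n div m * m + n mod m)" by simp
      also have "\<dots> \<le> real (n div m) * v m + v 0 + v (n mod m)"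
        using sub[of "n div m * m" "n mod m"] mult[of "n div m" m] by linarith
      also have "v (n mod m) \<le> (\<Sum>r<m. v r)"
        using m by (intro member_le_sum) (auto simp: nonneg)
      also have "real (n div m) * v m \<le> real n / real m * v m"
        by (intro mult_right_mono nonneg) (metis of_nat_div_le_of_nat)
      finally show ?thesis by (simp add: B_def)
    qed
    have "\<forall>\<^sub>F n in sequentially. n > nat \<lceil>B / (e/2)\<rceil>" by (rule eventually_gt_at_top)
    then show ?thesis
    proof eventually_elim
      case (elim n)
      then have "B / (e / 2) < real n" using real_nat_ceiling_ge[of "B / (e / 2)"] by linarith
      then have n: "B < e / 2 * real n" "n > 0"
        using e elim by (auto simp: field_simps)
      have "v n / real n \<le> v m / real m + B / real n"
        using v[of n] n by (simp add: field_simps)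
      also have "B / real n < e / 2" using n by (simp add: field_simps)
      finally show ?case using m by linarith
    qed
  qed
  have "(\<lambda>n. v n / real n) \<longlonglongrightarrow> L"
  proof (rule order_tendstoI)
    fix y assume "y < L"
    then show "\<forall>\<^sub>F n in sequentially. y < v n / real n"
      by (intro eventually_mono[OF eventually_ge_at_top[of 1]] less_le_trans[OF _ lower])
  next
    fix y assume "L < y"
    then show "\<forall>\<^sub>F n in sequentially. v n / real n < y"
      using upper[of "y - L"] by simp
  qed
  then show ?thesis by (auto simp: convergent_def)
qed

section \<open>Total variation on the unit interval\<close>

lemma total_variation01_ge:
  assumes "mono_on {..n} t" "t ` {..n} \<subseteq> {0..1}"
  shows "(\<Sum>i<n. ennreal \<bar>u (t (Suc i)) - u (t i)\<bar>) \<le> total_variation01 u"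
  unfolding total_variation01_def by (rule SUP_upper2[of "(n, t)"]) (use assms in auto)

text \<open>Reversing the partition reduces this to the increasing case. It serves orbits that move
  to the left.\<close>

lemma total_variation01_ge_antimono:
  assumes "\<And>i j. i \<le> j \<Longrightarrow> j \<le> n \<Longrightarrow> t j \<le> t i" "t ` {..n} \<subseteq> {0..1}"
  shows "(\<Sum>i<n. ennreal \<bar>u (t (Suc i)) - u (t i)\<bar>) \<le> total_variation01 u"
proof -
  have "(\<Sum>i<n. ennreal \<bar>u (t (Suc i)) - u (t i)\<bar>) = (\<Sum>i<n. ennreal \<bar>u (t (Suc (n - Suc i))) - u (t (n - Suc i))\<bar>)"
    by (rule sum.nat_diff_reindex[symmetric])
  also have "\<dots> = (\<Sum>i<n. ennreal \<bar>u (t (n - Suc i)) - u (t (n - i))\<bar>)"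
    by (intro sum.cong) (auto simp: abs_minus_commute Suc_diff_Suc)
  also have "\<dots> \<le> total_variation01 u"
    using assms by (intro total_variation01_ge[where t = "\<lambda>i. t (n - i)"]) (auto intro!: mono_onI)
  finally show ?thesis .
qed

lemma total_variation01_le:
  assumes "\<And>n t. mono_on {..n} t \<Longrightarrow> t ` {..n} \<subseteq> {0..1} \<Longrightarrow>
    (\<Sum>i<n. ennreal \<bar>u (t (Suc i)) - u (t i)\<bar>) \<le> B"
  shows "total_variation01 u \<le> B"
  unfolding total_variation01_def by (rule SUP_least) (use assms in auto)

lemma total_variation01_cong:
  assumes "\<And>x. x \<in> {0..1} \<Longrightarrow> u x = v x"
  shows "total_variation01 u = total_variation01 v"
  unfolding total_variation01_def
  by (intro SUP_cong refl) (force simp: image_subset_iff assms intro!: sum.cong)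

lemma total_variation01_lipschitz:
  assumes lip: "\<And>x y. x \<in> {0..1} \<Longrightarrow> y \<in> {0..1} \<Longrightarrow> \<bar>u x - u y\<bar> \<le> K * \<bar>x - y\<bar>"
  shows "total_variation01 u \<le> ennreal K"
proof (rule total_variation01_le)
  fix n :: nat and t :: "nat \<Rightarrow> real"
  assume mono: "mono_on {..n} t" and t: "t ` {..n} \<subseteq> {0..1}"
  have K: "K \<ge> 0" using lip[of 0 1] by auto
  have "(\<Sum>i<n. ennreal \<bar>u (t (Suc i)) - u (t i)\<bar>) = ennreal (\<Sum>i<n. \<bar>u (t (Suc i)) - u (t i)\<bar>)"
    by (rule sum_ennreal) auto
  also have "(\<Sum>i<n. \<bar>u (t (Suc i)) - u (t i)\<bar>) \<le> (\<Sum>i<n. K * (t (Suc i) - t i))"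
  proof (rule sum_mono)
    fix i assume i: "i \<in> {..<n}"
    then have "t i \<le> t (Suc i)" by (intro mono_onD[OF mono]) auto
    then show "\<bar>u (t (Suc i)) - u (t i)\<bar> \<le> K * (t (Suc i) - t i)"
      using lip[of "t (Suc i)" "t i"] t i by (auto simp: image_subset_iff)
  qed
  also have "\<dots> = K * (t n - t 0)"
    by (simp add: sum_distrib_left[symmetric] sum_lessThan_telescope)
  also have "\<dots> \<le> K * 1"
  proof (rule mult_left_mono[OF _ K])
    have "t n \<le> 1" "0 \<le> t 0" using t by (auto simp: image_subset_iff)
    then show "t n - t 0 \<le> 1" by simp
  qed
  finally show "(\<Sum>i<n. ennreal \<bar>u (t (Suc i)) - u (t i)\<bar>) \<le> ennreal K"
    by (simp add: ennreal_leI)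
qed

text \<open>A monotone h carries partitions to partitions. With h = f^n, u = log Df^m and v = log
  Df^n, the chain rule turns this into subadditivity of the variation of log Df^n.\<close>

lemma total_variation01_add_comp:
  assumes h: "mono_on {0..1} h" "h ` {0..1} \<subseteq> {0..1}"
  shows "total_variation01 (\<lambda>x. u (h x) + v x) \<le> total_variation01 u + total_variation01 v"
proof (rule total_variation01_le)
  fix n :: nat and t :: "nat \<Rightarrow> real"
  assume mono: "mono_on {..n} t" and t: "t ` {..n} \<subseteq> {0..1}"
  have "(\<Sum>i<n. ennreal \<bar>(u (h (t (Suc i))) + v (t (Suc i))) - (u (h (t i)) + v (t i))\<bar>)
    \<le> (\<Sum>i<n. ennreal \<bar>u (h (t (Suc i))) - u (h (t i))\<bar> + ennreal \<bar>v (t (Suc i)) - v (t i)\<bar>)"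
    by (intro sum_mono) (auto simp flip: ennreal_plus intro!: ennreal_leI)
  also have "\<dots> = (\<Sum>i<n. ennreal \<bar>u (h (t (Suc i))) - u (h (t i))\<bar>) + (\<Sum>i<n. ennreal \<bar>v (t (Suc i)) - v (t i)\<bar>)"
    by (rule sum.distrib)
  also have "\<dots> \<le> total_variation01 u + total_variation01 v"
  proof (rule add_mono)
    show "(\<Sum>i<n. ennreal \<bar>u (h (t (Suc i))) - u (h (t i))\<bar>) \<le> total_variation01 u"
    proof (rule total_variation01_ge[where t = "\<lambda>i. h (t i)"])
      show "mono_on {..n} (\<lambda>i. h (t i))"
        using t by (intro mono_onI mono_onD[OF h(1)] mono_onD[OF mono]) (auto simp: image_subset_iff)
    qed (use t h in \<open>auto simp: image_subset_iff\<close>)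
  qed (rule total_variation01_ge[OF mono t])
  finally show "(\<Sum>i<n. ennreal \<bar>(u (h (t (Suc i))) + v (t (Suc i))) - (u (h (t i)) + v (t i))\<bar>)
    \<le> total_variation01 u + total_variation01 v" .
qed

section \<open>Actions of the integers by diffeomorphisms of the interval\<close>

text \<open>The points x 0, u 0, x 1, u 1, ... form a single monotone partition \<open>t\<close>;
  discarding the gaps from u i to x (i + 1) only lowers the sum.\<close>

lemma total_variation01_ge_disjoint_intervals:
  fixes x u :: "nat \<Rightarrow> real"
  assumes chain: "(\<forall>i. x i \<le> u i \<and> u i \<le> x (Suc i)) \<or> (\<forall>i. x (Suc i) \<le> u i \<and> u i \<le> x i)"
    and "\<And>i. x i \<in> {0..1}" "\<And>i. u i \<in> {0..1}"
  shows "(\<Sum>i<N. ennreal \<bar>f (u i) - f (x i)\<bar>) \<le> total_variation01 f"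
proof -
  define t where "t = (\<lambda>k. if even k then x (k div 2) else u (k div 2))"
  have "(\<Sum>i<N. ennreal \<bar>f (u i) - f (x i)\<bar>) \<le> (\<Sum>k<2*N. ennreal \<bar>f (t (Suc k)) - f (t k)\<bar>)"
  proof (induction N)
    case (Suc N)
    have "(\<Sum>k<2 * Suc N. ennreal \<bar>f (t (Suc k)) - f (t k)\<bar>) =
       ((\<Sum>k<2*N. ennreal \<bar>f (t (Suc k)) - f (t k)\<bar>) + ennreal \<bar>f (u N) - f (x N)\<bar>) + ennreal \<bar>f (x (Suc N)) - f (u N)\<bar>"
      by (simp add: t_def)
    also have "\<dots> \<ge> (\<Sum>k<2*N. ennreal \<bar>f (t (Suc k)) - f (t k)\<bar>) + ennreal \<bar>f (u N) - f (x N)\<bar>"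
      by simp
    finally show ?case
      using Suc add_right_mono order_trans unfolding sum.lessThan_Suc by blast
  qed simp
  also have "\<dots> \<le> total_variation01 f"
    using chain
  proof
    assume c: "\<forall>i. x i \<le> u i \<and> u i \<le> x (Suc i)"
    have "t k \<le> t (Suc k)" for k using c by (auto simp: t_def elim!: oddE evenE)
    then have "t i \<le> t j" if "i \<le> j" for i j using lift_Suc_mono_le[of t] that by blast
    then show ?thesis
      using assms(2,3) by (intro total_variation01_ge mono_onI) (auto simp: t_def)
  next
    assume c: "\<forall>i. x (Suc i) \<le> u i \<and> u i \<le> x i"
    have "t (Suc k) \<le> t k" for k using c by (auto simp: t_def elim!: oddE evenE)
    then have "t j \<le> t i" if "i \<le> j" for i j using lift_Suc_antimono_le[of t] that by blast
    then show ?thesis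
      using assms(2,3) by (intro total_variation01_ge_antimono) (auto simp: t_def)
  qed
  finally show ?thesis .
qed

section \<open>Integer iterates and bounded distortion\<close>

text \<open>All integer powers occur because the unfolding uses whole orbits. The extension by the
  identity makes each \<open>F j\<close> an increasing bijection of the line, so that integrals can
  be transformed on the whole line and group identities hold without side conditions. Quantitative
  regularity is recorded for f itself only: \<open>K\<close> is a Lipschitz constant of log Df, and
  \<open>C\<close> bounds c(f).\<close>

locale interval_action =
  fixes F DF :: "int \<Rightarrow> real \<Rightarrow> real" and K C :: real
  assumes F_0 [simp]: "F 0 x = x"
    and F_add: "F (i + j) x = F i (F j x)"
    and F_less: "x < y \<Longrightarrow> F j x < F j y"
    and F_outside: "x \<notin> {0..1} \<Longrightarrow> F j x = x"
    and DF_outside: "x \<notin> {0..1} \<Longrightarrow> DF j x = 1"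
    and DF: "x \<in> {0..1} \<Longrightarrow> (F j has_real_derivative DF j x) (at x within {0..1})"
    and DF_cont: "continuous_on {0..1} (DF j)"
    and DF_pos: "DF j x > 0"
    and DF_add: "DF (i + j) x = DF i (F j x) * DF j x"
    and lipschitz: "x \<in> {0..1} \<Longrightarrow> y \<in> {0..1} \<Longrightarrow> \<bar>ln (DF 1 x) - ln (DF 1 y)\<bar> \<le> K * \<bar>x - y\<bar>"
    and kernel_bound: "x \<in> {0..1} \<Longrightarrow> y \<in> {0..1} \<Longrightarrow> x \<noteq> y \<Longrightarrow>
      \<bar>DF 1 x * DF 1 y / (F 1 x - F 1 y)\<^sup>2 - 1 / (x - y)\<^sup>2\<bar> \<le> C"
begin

lemma DF_0 [simp]: "DF 0 x = 1"
  using DF_add[of 0 0 x] DF_pos[of 0 x] by simp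

lemma DF_nonzero [simp]: "DF j x \<noteq> 0"
  using DF_pos[of j x] by simp

lemma DF_nonneg [simp]: "DF j x \<ge> 0"
  using DF_pos[of j x] by simp

lemma F_inverse [simp]: "F (- j) (F j x) = x" "F j (F (- j) x) = x"
  using F_add[of "-j" j x] F_add[of j "-j" x] by auto

lemma F_less_iff [simp]: "F j x < F j y \<longleftrightarrow> x < y"
  by (metis F_less F_inverse(1))

lemma F_le_iff [simp]: "F j x \<le> F j y \<longleftrightarrow> x \<le> y"
  by (meson F_less_iff linorder_not_le)

lemma F_eq_iff [simp]: "F j x = F j y \<longleftrightarrow> x = y"
  by (metis F_inverse(1))

lemma F_in: "x \<in> {0..1} \<Longrightarrow> F j x \<in> {0..1}"
  using F_outside[of "F j x" "- j"] by force

lemma F_endpoints [simp]: "F j 0 = 0" "F j 1 = 1"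
proof -
  have "F j 0 \<le> F j (F (- j) 0)" "F j (F (- j) 1) \<le> F j 1"
    using F_in[of 0 "- j"] F_in[of 1 "- j"] unfolding F_le_iff by auto
  then show "F j 0 = 0" "F j 1 = 1"
    using F_in[of 0 j] F_in[of 1 j] by auto
qed

lemma F_nonneg_iff [simp]: "0 \<le> F j x \<longleftrightarrow> 0 \<le> x"
  using F_le_iff[of j 0 x] by simp

lemma F_le_1_iff [simp]: "F j x \<le> 1 \<longleftrightarrow> x \<le> 1"
  using F_le_iff[of j x 1] by simp

lemma F_cont: "continuous_on {0..1} (F j)"
  using DF by (rule DERIV_continuous_on)

lemma F_fixed: assumes "F 1 q = q" shows "F j q = q"
proof (induction j rule: int_induct[where k = 0])
  case (step1 i)
  then show ?case using F_add[of i 1 q] assms by simp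
next
  case (step2 i)
  then show ?case using F_add[of "i - 1" 1 q] assms by simp
qed simp

lemma fixed_of_inverse: "F (-1) q = q \<Longrightarrow> F 1 q = q"
  by (metis F_inverse(2))

lemma fixed_shift [simp]: "F 1 (F j x) = F j x \<longleftrightarrow> F 1 x = x"
  by (metis F_add add.commute F_eq_iff)

lemma F_not_fixed: "F 1 x \<noteq> x \<Longrightarrow> F 1 q = q \<Longrightarrow> F j x \<noteq> q"
  by (metis fixed_shift)

lemma F_mono_index: assumes "x \<le> F 1 x" "i \<le> j" shows "F i x \<le> F j x"
proof -
  have "F i x \<le> F (i + int n) x" for n
  proof (induction n)
    case (Suc n)
    have "F (i + int n) x \<le> F (i + int n) (F 1 x)" using assms by simp
    also have "\<dots> = F (i + int (Suc n)) x" using F_add[of "i + int n" 1 x] by (simp add: ac_simps)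
    finally show ?case using Suc by linarith
  qed simp
  from this[of "nat (j - i)"] show ?thesis using assms by simp
qed

lemma F_antimono_index: assumes "F 1 x \<le> x" "i \<le> j" shows "F j x \<le> F i x"
proof -
  have "F (i + int n) x \<le> F i x" for n
  proof (induction n)
    case (Suc n)
    have "F (i + int (Suc n)) x = F (i + int n) (F 1 x)" using F_add[of "i + int n" 1 x] by (simp add: ac_simps)
    also have "\<dots> \<le> F (i + int n) x" using assms by simp
    finally show ?case using Suc by linarith
  qed simp
  from this[of "nat (j - i)"] show ?thesis using assms by simp
qed

text \<open>The sign \<open>s\<close> of the displacement makes \<open>s * F j x\<close> increasing in \<open>j\<close>,
  whichever way \<open>x\<close> moves.\<close>

lemma obtain_direction:
  obtains s :: real where "s = 1 \<or> s = -1" "\<And>i j. i \<le> j \<Longrightarrow> s * F i x \<le> s * F j x"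
proof (cases "x \<le> F 1 x")
  case True
  then show ?thesis using that[of 1] F_mono_index by simp
next
  case False
  then show ?thesis using that[of "-1"] F_antimono_index by simp
qed

lemma orbit_tendsto:
  assumes x: "x \<in> {0..1}" and s: "s = 1 \<or> s = (-1::int)"
  obtains p where "p \<in> {0..1}" "F 1 p = p" "(\<lambda>n. F (s * int n) x) \<longlonglongrightarrow> p"
proof -
  have "monoseq (\<lambda>n. F (s * int n) x)"
  proof (cases "x \<le> F 1 x")
    case True
    then show ?thesis using s F_mono_index[of x] by (auto simp: monoseq_def)
  next
    case False
    then show ?thesis using s F_antimono_index[of x] by (auto simp: monoseq_def)
  qed
  moreover have "Bseq (\<lambda>n. F (s * int n) x)"
    using x by (intro BseqI'[where K=1]) simp
  ultimately obtain p where p: "(\<lambda>n. F (s * int n) x) \<longlonglongrightarrow> p"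
    using Bseq_monoseq_convergent convergent_def by blast
  have pI: "p \<in> {0..1}"
    using LIMSEQ_le_const[OF p, of 0] LIMSEQ_le_const2[OF p, of 1] x by auto
  have "(\<lambda>n. F s (F (s * int n) x)) \<longlonglongrightarrow> F s p"
    by (rule continuous_on_tendsto_compose[OF F_cont p pI]) (use x in simp)
  moreover have "F s (F (s * int n) x) = F (s * int (Suc n)) x" for n
    using F_add[of s "s * int n" x] by (simp add: algebra_simps)
  ultimately have "(\<lambda>n. F (s * int (Suc n)) x) \<longlonglongrightarrow> F s p" by simp
  then have "F s p = p"
    using LIMSEQ_Suc[OF p] LIMSEQ_unique by blast
  then have "F 1 p = p" using s fixed_of_inverse by auto
  then show ?thesis using that pI p by blast
qed

definition ld :: "int \<Rightarrow> real \<Rightarrow> real" where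
  "ld j x = ln (DF j x)"

lemma ld_add: "ld (i + j) x = ld i (F j x) + ld j x"
  by (simp add: ld_def DF_add ln_mult_pos DF_pos)

lemma ld_0 [simp]: "ld 0 x = 0" by (simp add: ld_def)

lemma exp_ld: "exp (ld j x) = DF j x" by (simp add: ld_def DF_pos)

lemma K_nonneg: "K \<ge> 0"
  using lipschitz[of 0 1] by auto

text \<open>Since u lies between x and f(x), the intervals from f^l(x) to f^l(u) for l between i and
  j do not overlap, and their lengths add up to at most |f^i(x) - f^j(x)|. Keeping this distance in
  the bound, instead of replacing it by 1, makes the differences Cauchy along a convergent
  orbit.\<close>

lemma distortion:
  assumes x: "x \<in> {0..1}" and u: "x \<le> u \<and> u \<le> F 1 x \<or> F 1 x \<le> u \<and> u \<le> x"
  shows "\<bar>(ld i u - ld i x) - (ld j u - ld j x)\<bar> \<le> K * \<bar>F i x - F j x\<bar>"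
proof -
  have uI: "u \<in> {0..1}" using u F_in[OF x, of 1] x unfolding atLeastAtMost_iff by linarith
  obtain s :: real where s: "s = 1 \<or> s = -1" "\<And>i j. i \<le> j \<Longrightarrow> s * F i x \<le> s * F j x"
    using obtain_direction by blast
  have step: "\<bar>(ld (i + 1) u - ld (i + 1) x) - (ld i u - ld i x)\<bar> \<le> K * (s * F (i + 1) x - s * F i x)" for i
  proof -
    have "F i (F 1 x) = F (i + 1) x" using F_add[of i 1 x] by simp
    then have "F i x \<le> F i u \<and> F i u \<le> F (i + 1) x \<or> F (i + 1) x \<le> F i u \<and> F i u \<le> F i x"
      using u F_le_iff by metis
    then have le: "\<bar>F i u - F i x\<bar> \<le> \<bar>F (i + 1) x - F i x\<bar>" by linarith
    have eq: "s * F (i + 1) x - s * F i x = \<bar>F (i + 1) x - F i x\<bar>"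
      using s(2)[of i "i+1"] s(1) by auto
    have "(ld (i + 1) u - ld (i + 1) x) - (ld i u - ld i x) = ld 1 (F i u) - ld 1 (F i x)"
      using ld_add[of 1 i u] ld_add[of 1 i x] by (simp add: add.commute)
    then have "\<bar>(ld (i + 1) u - ld (i + 1) x) - (ld i u - ld i x)\<bar> \<le> K * \<bar>F i u - F i x\<bar>"
      using lipschitz[OF F_in[OF uI] F_in[OF x]] by (simp add: ld_def)
    also have "\<dots> \<le> K * \<bar>F (i + 1) x - F i x\<bar>"
      using le K_nonneg by (rule mult_left_mono)
    finally show ?thesis using eq by simp
  qed
  have steps: "\<bar>(ld (i + int n) u - ld (i + int n) x) - (ld i u - ld i x)\<bar> \<le> K * (s * F (i + int n) x - s * F i x)" for i n
  proof (induction n)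
    case (Suc n)
    have "i + int (Suc n) = i + int n + 1" by simp
    then show ?case using Suc step[of "i + int n"] by (simp add: algebra_simps)
  qed simp
  have ordered: "\<bar>(ld j u - ld j x) - (ld i u - ld i x)\<bar> \<le> K * \<bar>F j x - F i x\<bar>" if "i \<le> j" for i j
  proof -
    have "s * F j x - s * F i x = \<bar>F j x - F i x\<bar>" using s(2)[OF that] s(1) by auto
    then show ?thesis using steps[of i "nat (j - i)"] that by simp
  qed
  show ?thesis
    using ordered[of i j] ordered[of j i] by (cases "i \<le> j") (auto simp: abs_minus_commute)
qed

text \<open>Fekete's lemma is about reals, so finiteness comes first: by subadditivity and the
  Lipschitz bound for log Df the variation of log Df^n is at most nK.\<close>

lemma total_variation_ld_convergent:
  "convergent (\<lambda>n. total_variation01 (ld (int n)) / of_nat n)"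
proof -
  have add: "total_variation01 (ld (int (m + n))) \<le> total_variation01 (ld (int m)) + total_variation01 (ld (int n))" for m n
  proof -
    have "ld (int (m + n)) = (\<lambda>x. ld (int m) (F (int n) x) + ld (int n) x)"
      by (rule ext) (simp add: ld_add)
    then have "total_variation01 (ld (int (m + n))) = total_variation01 (\<lambda>x. ld (int m) (F (int n) x) + ld (int n) x)"
      by simp
    also have "\<dots> \<le> total_variation01 (ld (int m)) + total_variation01 (ld (int n))"
      by (rule total_variation01_add_comp) (auto intro!: mono_onI)
    finally show ?thesis .
  qed
  have 1: "total_variation01 (ld 1) \<le> ennreal K"
    by (rule total_variation01_lipschitz) (simp add: ld_def lipschitz)
  have fin: "total_variation01 (ld (int n)) \<le> of_nat n * ennreal K" for n
  proof (induction n)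
    case (Suc n)
    have "total_variation01 (ld (int (Suc n))) \<le> total_variation01 (ld 1) + total_variation01 (ld (int n))"
      using add[of 1 n] by simp
    also have "\<dots> \<le> ennreal K + of_nat n * ennreal K" by (intro add_mono 1 Suc)
    finally show ?case by (simp add: algebra_simps)
  qed (use total_variation01_lipschitz[of "\<lambda>x. 0" 0] in simp)
  have lt: "total_variation01 (ld (int n)) < top" for n
    by (rule le_less_trans[OF fin]) (simp add: ennreal_mult_less_top of_nat_less_top)
  define v where "v = (\<lambda>n. enn2real (total_variation01 (ld (int n))))"
  have v: "total_variation01 (ld (int n)) = ennreal (v n)" for n
    using lt[of n] by (simp add: v_def)
  have vn: "v n \<ge> 0" for n by (simp add: v_def)
  have "convergent (\<lambda>n. v n / real n)"
  proof (rule Fekete_convergent)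
    show "v n \<ge> 0" for n by (rule vn)
    show "v (m + n) \<le> v m + v n" for m n
      using add[of m n] vn unfolding v by (simp add: ennreal_le_iff add_nonneg_nonneg flip: ennreal_plus)
  qed
  then obtain L where L: "(\<lambda>n. v n / real n) \<longlonglongrightarrow> L" by (auto simp: convergent_def)
  then have "(\<lambda>n. ennreal (v n / real n)) \<longlonglongrightarrow> ennreal L" by (rule tendsto_ennrealI)
  moreover have "\<forall>\<^sub>F n in sequentially. ennreal (v n / real n) = total_variation01 (ld (int n)) / of_nat n"
    using eventually_gt_at_top[of 0]
    by eventually_elim (simp add: v vn divide_ennreal ennreal_of_nat_eq_real_of_nat)
  ultimately have "(\<lambda>n. total_variation01 (ld (int n)) / of_nat n) \<longlonglongrightarrow> ennreal L"
    by (rule Lim_transform_eventually)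
  then show ?thesis by (auto simp: convergent_def)
qed

end

section \<open>Distortion limits under vanishing variation\<close>

locale vanishing_variation_action = interval_action +
  assumes vanishing: "(\<lambda>n. total_variation01 (ld (int n)) / of_nat n) \<longlonglongrightarrow> 0"
begin

text \<open>Both limits exist because \<open>distortion\<close> transfers the Cauchy property from
  the orbit of x. If they were 3d apart, the increment of log Df^n would be at least d on all but 2m
  of n consecutive translates of the interval between x and u, with m independent of n. For n at
  least 4m the variation divided by n would then be at least d/2.\<close>

lemma distortion_limits_step:
  assumes x: "x \<in> {0..1}" and u: "x \<le> u \<and> u \<le> F 1 x \<or> F 1 x \<le> u \<and> u \<le> x"
  shows "(\<lambda>n. (ld (int n) u - ld (int n) x) - (ld (- int n) u - ld (- int n) x)) \<longlonglongrightarrow> 0"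
proof -
  define b where "b = (\<lambda>j. ld j u - ld j x)"
  have uI: "u \<in> {0..1}" using u F_in[OF x, of 1] x unfolding atLeastAtMost_iff by linarith
  have b: "\<bar>b i - b j\<bar> \<le> K * \<bar>F i x - F j x\<bar>" for i j
    using distortion[OF assms] by (simp add: b_def)
  have conv: "convergent (\<lambda>n. b (s * int n))" if s: "s = 1 \<or> s = -1" for s
  proof -
    obtain p where "(\<lambda>n. F (s * int n) x) \<longlonglongrightarrow> p" using orbit_tendsto[OF x s] by blast
    then have C: "Cauchy (\<lambda>n. F (s * int n) x)" by (rule LIMSEQ_imp_Cauchy)
    have "Cauchy (\<lambda>n. b (s * int n))"
    proof (rule metric_CauchyI)
      fix e :: real assume e: "e > 0"
      then have "e / (K + 1) > 0" using K_nonneg by simp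
      from metric_CauchyD[OF C this] obtain M where
        M: "\<forall>m\<ge>M. \<forall>n\<ge>M. dist (F (s * int m) x) (F (s * int n) x) < e / (K + 1)" by blast
      have "dist (b (s * int m)) (b (s * int n)) < e" if "m \<ge> M" "n \<ge> M" for m n
      proof -
        have "dist (b (s * int m)) (b (s * int n)) \<le> K * dist (F (s * int m) x) (F (s * int n) x)"
          using b by (simp add: dist_real_def)
        also have "\<dots> \<le> (K + 1) * dist (F (s * int m) x) (F (s * int n) x)"
          by (intro mult_right_mono) auto
        also have "\<dots> < e" using M that K_nonneg by (simp add: field_simps)
        finally show ?thesis .
      qed
      then show "\<exists>M. \<forall>m\<ge>M. \<forall>n\<ge>M. dist (b (s * int m)) (b (s * int n)) < e" by blast
    qed
    then show ?thesis by (rule Cauchy_convergent)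
  qed
  obtain l l' where l: "(\<lambda>n. b (int n)) \<longlonglongrightarrow> l" and l': "(\<lambda>n. b (- int n)) \<longlonglongrightarrow> l'"
    using conv[of 1] conv[of "-1"] by (auto simp: convergent_def)
  have "l = l'"
  proof (rule ccontr)
    assume neq: "l \<noteq> l'"
    define d where "d = \<bar>l - l'\<bar> / 3"
    have d: "d > 0" using neq by (simp add: d_def)
    have "\<forall>\<^sub>F n in sequentially. \<bar>b (int n) - l\<bar> < d" "\<forall>\<^sub>F n in sequentially. \<bar>b (- int n) - l'\<bar> < d"
      using l[THEN tendstoD, OF d] l'[THEN tendstoD, OF d] by (simp_all add: dist_real_def)
    then obtain m where m: "\<And>n. n \<ge> m \<Longrightarrow> \<bar>b (int n) - l\<bar> < d" "\<And>n. n \<ge> m \<Longrightarrow> \<bar>b (- int n) - l'\<bar> < d"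
      unfolding eventually_sequentially by (metis le_cases order_trans)
    have far: "d \<le> \<bar>b (int p) - b (- int q)\<bar>" if "p \<ge> m" "q \<ge> m" for p q
    proof -
      have "\<bar>l - l'\<bar> \<le> \<bar>b (int p) - l\<bar> + \<bar>b (int p) - b (- int q)\<bar> + \<bar>b (- int q) - l'\<bar>" by arith
      moreover have "\<bar>l - l'\<bar> = 3 * d" by (simp add: d_def)
      ultimately show ?thesis using m(1)[OF that(1)] m(2)[OF that(2)] by linarith
    qed
    have big: "ennreal (d / 2) \<le> total_variation01 (ld (int n)) / of_nat n" if n: "n \<ge> 4 * m" "n > 0" for n
    proof -
      \<comment> \<open>Chosen so that f^n leads from the index -(n - m - i) to i + m. For i < n -
        2m both are at least m in absolute value, hence close to the two limits.\<close>
      define st where "st i = int i + int m - int n" for i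
      have "(\<Sum>i<n - 2*m. ennreal \<bar>ld (int n) (F (st i) u) - ld (int n) (F (st i) x)\<bar>) \<le> total_variation01 (ld (int n))"
      proof (rule total_variation01_ge_disjoint_intervals)
        have "F (st i) (F 1 x) = F (st (Suc i)) x" for i
          using F_add[of "st i" 1 x] by (simp add: st_def algebra_simps)
        then show "(\<forall>i. F (st i) x \<le> F (st i) u \<and> F (st i) u \<le> F (st (Suc i)) x) \<or>
           (\<forall>i. F (st (Suc i)) x \<le> F (st i) u \<and> F (st i) u \<le> F (st i) x)"
          using u F_le_iff by metis
      qed (use x uI in auto)
      moreover have "(\<Sum>i<n - 2*m. ennreal d) \<le> (\<Sum>i<n - 2*m. ennreal \<bar>ld (int n) (F (st i) u) - ld (int n) (F (st i) x)\<bar>)"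
      proof (intro sum_mono ennreal_leI)
        fix i assume i: "i \<in> {..<n - 2*m}"
        have "ld (int n) (F (st i) u) - ld (int n) (F (st i) x) = b (int n + st i) - b (st i)"
          using ld_add[of "int n" "st i"] by (simp add: b_def)
        moreover have "int n + st i = int (i + m)" "st i = - int (n - m - i)"
          using i by (auto simp: st_def)
        moreover have "m \<le> i + m" "m \<le> n - m - i" using i by auto
        ultimately show "d \<le> \<bar>ld (int n) (F (st i) u) - ld (int n) (F (st i) x)\<bar>"
          using far[of "i + m" "n - m - i"] by metis
      qed
      ultimately have "of_nat (n - 2*m) * ennreal d \<le> total_variation01 (ld (int n))" by simp
      then have "ennreal (real (n - 2*m) * d) / of_nat n \<le> total_variation01 (ld (int n)) / of_nat n"
        using d by (intro divide_right_mono_ennreal) (simp add: ennreal_mult ennreal_of_nat_eq_real_of_nat)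
      moreover have "ennreal (d / 2) \<le> ennreal (real (n - 2*m) * d) / of_nat n"
      proof -
        have "d * real n \<le> d * (2 * real (n - 2*m))" using n d by (intro mult_left_mono) auto
        then have "d / 2 \<le> real (n - 2*m) * d / real n" using n d by (simp add: field_simps)
        then show ?thesis using n d
          by (simp add: ennreal_of_nat_eq_real_of_nat divide_ennreal ennreal_leI)
      qed
      ultimately show ?thesis by (rule order_trans[rotated])
    qed
    have "\<forall>\<^sub>F n in sequentially. total_variation01 (ld (int n)) / of_nat n < ennreal (d / 2)"
      using vanishing d by (intro order_tendstoD(2)[where y=0]) auto
    then have "\<forall>\<^sub>F n in sequentially. False"
      using eventually_ge_at_top[of "4*m"] eventually_gt_at_top[of 0]
      by eventually_elim (use big in \<open>meson leD\<close>)
    then show False by simp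
  qed
  then show ?thesis using tendsto_diff[OF l l'] by (simp add: b_def)
qed

end

section \<open>The kernel along an orbit\<close>

lemma abs_diff_le_1: "x \<in> {0..1} \<Longrightarrow> y \<in> {0..1} \<Longrightarrow> \<bar>x - y\<bar> \<le> (1::real)"
  by (auto simp: abs_le_iff)

text \<open>Phrased with differences and uniform bounds, as it will be applied to two sequences, one
  for each end of an orbit, that approach each other.\<close>

lemma tendsto_diff_quotient_sq:
  fixes v v' w w' :: "nat \<Rightarrow> real"
  assumes v: "(\<lambda>n. v n - v' n) \<longlonglongrightarrow> 0" and w: "(\<lambda>n. w n - w' n) \<longlonglongrightarrow> 0"
    and V: "\<And>n. \<bar>v' n\<bar> \<le> V"
    and c: "c > 0" "\<And>n. c \<le> w n" "\<And>n. c \<le> w' n" and W: "\<And>n. w n \<le> W" "\<And>n. w' n \<le> W"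
  shows "(\<lambda>n. v n / (w n)\<^sup>2 - v' n / (w' n)\<^sup>2) \<longlonglongrightarrow> 0"
proof (rule Lim_null_comparison)
  have W0: "W > 0" using c W[of 0] by (meson less_le_trans order_trans)
  have V0: "V \<ge> 0" using V[of 0] by simp
  show "\<forall>\<^sub>F n in sequentially. norm (v n / (w n)\<^sup>2 - v' n / (w' n)\<^sup>2)
     \<le> (\<bar>v n - v' n\<bar> * W\<^sup>2 + V * (\<bar>w n - w' n\<bar> * (2 * W))) / c ^ 4"
  proof (rule always_eventually, rule allI)
    fix n
    have pos: "w n > 0" "w' n > 0" using c by (meson less_le_trans)+
    define N where "N = (v n - v' n) * (w' n)\<^sup>2 + v' n * ((w' n - w n) * (w' n + w n))"
    have "v n / (w n)\<^sup>2 - v' n / (w' n)\<^sup>2 = N / ((w n)\<^sup>2 * (w' n)\<^sup>2)"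
      using pos by (simp add: N_def field_simps power2_eq_square)
    then have "norm (v n / (w n)\<^sup>2 - v' n / (w' n)\<^sup>2) = \<bar>N\<bar> / ((w n)\<^sup>2 * (w' n)\<^sup>2)"
      by (simp add: abs_divide)
    also have "\<dots> \<le> (\<bar>v n - v' n\<bar> * W\<^sup>2 + V * (\<bar>w n - w' n\<bar> * (2 * W))) / (c\<^sup>2 * c\<^sup>2)"
    proof (rule frac_le)
      have "\<bar>N\<bar> \<le> \<bar>v n - v' n\<bar> * (w' n)\<^sup>2 + \<bar>v' n\<bar> * (\<bar>w n - w' n\<bar> * (w' n + w n))"
        unfolding N_def using pos
        by (intro order_trans[OF abs_triangle_ineq] add_mono) (auto simp: abs_mult abs_minus_commute)
      also have "\<dots> \<le> \<bar>v n - v' n\<bar> * W\<^sup>2 + V * (\<bar>w n - w' n\<bar> * (2 * W))"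
        using pos V[of n] W[of n] V0 W0
        by (intro add_mono mult_mono power_mono mult_nonneg_nonneg) auto
      finally show "\<bar>N\<bar> \<le> \<bar>v n - v' n\<bar> * W\<^sup>2 + V * (\<bar>w n - w' n\<bar> * (2 * W))" .
      show "c\<^sup>2 * c\<^sup>2 \<le> (w n)\<^sup>2 * (w' n)\<^sup>2"
        using c by (intro mult_mono power_mono) auto
    qed (use c V0 W0 in auto)
    finally show "norm (v n / (w n)\<^sup>2 - v' n / (w' n)\<^sup>2)
     \<le> (\<bar>v n - v' n\<bar> * W\<^sup>2 + V * (\<bar>w n - w' n\<bar> * (2 * W))) / c ^ 4"
      by (simp flip: power_add)
  qed
  have "(\<lambda>n. (\<bar>v n - v' n\<bar> * W\<^sup>2 + V * (\<bar>w n - w' n\<bar> * (2 * W))) / c ^ 4) \<longlonglongrightarrow> (\<bar>0\<bar> * W\<^sup>2 + V * (\<bar>0\<bar> * (2 * W))) / c ^ 4"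
    using c by (intro tendsto_intros v w) auto
  then show "(\<lambda>n. (\<bar>v n - v' n\<bar> * W\<^sup>2 + V * (\<bar>w n - w' n\<bar> * (2 * W))) / c ^ 4) \<longlonglongrightarrow> 0"
    by simp
qed

context interval_action begin

definition k :: "int \<Rightarrow> real \<Rightarrow> real \<Rightarrow> real" where
  "k j x y = DF j x * DF j y / (F j x - F j y)\<^sup>2"

lemma k_commute: "k j x y = k j y x"
  by (simp add: k_def power2_commute mult.commute)

lemma ratio_tendsto:
  assumes "p \<in> {0..1}" "F 1 p = p" "\<And>n. z n \<in> {0..1}" "\<And>n. z n \<noteq> p" "z \<longlonglongrightarrow> p"
  shows "(\<lambda>n. (F 1 (z n) - p) / (z n - p)) \<longlonglongrightarrow> DF 1 p"
proof -
  have "((\<lambda>z. (F 1 z - F 1 p) / (z - p)) \<longlongrightarrow> DF 1 p) (at p within {0..1})"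
    using DF[OF assms(1), of 1] by (simp add: has_field_derivative_iff)
  moreover have "filterlim z (at p within {0..1}) sequentially"
    using assms by (simp add: filterlim_at)
  ultimately show ?thesis
    using filterlim_compose assms(2) by fastforce
qed

text \<open>By the mean value theorem the ratio of displacements is Df^j(u) for some u between x and
  f(x). Comparing the indices j and 0 in \<open>distortion\<close> replaces u by x at the cost of a
  factor exp K, since orbit points are at distance at most 1.\<close>

lemma DF_le_displacement:
  assumes x: "x \<in> {0..1}" and nf: "F 1 x \<noteq> x"
  shows "DF j x \<le> exp K / \<bar>F 1 x - x\<bar> * \<bar>F (j + 1) x - F j x\<bar>"
proof -
  define a where "a = min x (F 1 x)"
  define b where "b = max x (F 1 x)"
  have ab: "a < b" "{a..b} \<subseteq> {0..1}" using x nf F_in[OF x, of 1] by (auto simp: a_def b_def)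
  obtain u where u: "u \<in> {a<..<b}" "F j b - F j a = (*) (DF j u) (b - a)"
  proof -
    have "\<exists>u\<in>{a<..<b}. F j b - F j a = (*) (DF j u) (b - a)"
    proof (rule mvt_simple[OF ab(1)])
      fix u assume "a \<le> u" "u \<le> b"
      then have "(F j has_real_derivative DF j u) (at u within {a..b})"
        using ab by (intro has_field_derivative_subset[OF DF]) auto
      then show "(F j has_derivative (*) (DF j u)) (at u within {a..b})"
        by (simp add: has_field_derivative_def)
    qed
    then show ?thesis using that by blast
  qed
  have uI: "u \<in> {0..1}" using u ab by auto
  have "\<bar>(ld j u - ld j x) - (ld 0 u - ld 0 x)\<bar> \<le> K * \<bar>F j x - F 0 x\<bar>"
    by (rule distortion[OF x]) (use u in \<open>auto simp: a_def b_def min_def max_def split: if_splits\<close>)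
  also have "\<dots> \<le> K * 1"
    using F_in x K_nonneg unfolding F_0 by (intro mult_left_mono abs_diff_le_1)
  finally have "ld j x \<le> K + ld j u" by auto
  then have "exp (ld j x) \<le> exp (K + ld j u)" by simp
  then have le: "DF j x \<le> exp K * DF j u" by (simp add: exp_add exp_ld)
  have "F j (F 1 x) = F (j + 1) x" using F_add[of j 1 x] by simp
  then have "\<bar>F (j + 1) x - F j x\<bar> = \<bar>F j b - F j a\<bar>"
    using F_le_iff[of j x "F 1 x"] by (auto simp: a_def b_def min_def max_def simp del: F_le_iff)
  also have "\<dots> = DF j u * \<bar>F 1 x - x\<bar>"
    using u by (simp add: abs_mult a_def b_def min_def max_def)
  finally show ?thesis using le nf by (simp add: field_simps)
qed

end

context vanishing_variation_action begin

text \<open>Induction on the number M of steps x, f(x), f^2(x), ... that lead past u; each step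
  costs K by \<open>distortion\<close>. The sign s treats motion to the right and to the left at
  once.\<close>

lemma distortion_limits_chain:
  fixes s :: real
  assumes x: "x \<in> {0..1}" and s: "s = 1 \<or> s = -1" "s * x \<le> s * F 1 x"
    and u: "s * x \<le> s * u" "s * u \<le> s * F (int M) x"
  shows "\<bar>ld j u - ld j x\<bar> \<le> K * real M"
    "(\<lambda>n. (ld (int n) u - ld (int n) x) - (ld (- int n) u - ld (- int n) x)) \<longlonglongrightarrow> 0"
proof -
  have "(\<forall>j. \<bar>ld j u - ld j x\<bar> \<le> K * real M) \<and>
    (\<lambda>n. (ld (int n) u - ld (int n) x) - (ld (- int n) u - ld (- int n) x)) \<longlonglongrightarrow> 0"
    using u
  proof (induction M arbitrary: u)
    case 0
    then have "u = x" using s by auto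
    then show ?case by simp
  next
    case (Suc M)
    show ?case
    proof (cases "s * u \<le> s * F (int M) x")
      case True
      have "K * real M \<le> K * real (Suc M)" using K_nonneg by (intro mult_left_mono) auto
      then show ?thesis using Suc.IH[OF Suc.prems(1) True] order_trans by blast
    next
      case False
      define x' where "x' = F (int M) x"
      have x': "x' \<in> {0..1}" unfolding x'_def by (rule F_in[OF x])
      have "F 1 x' = F (int (Suc M)) x" using F_add[of 1 "int M" x] by (simp add: x'_def)
      with False Suc.prems s have btw: "x' \<le> u \<and> u \<le> F 1 x' \<or> F 1 x' \<le> u \<and> u \<le> x'"
        by (auto simp: x'_def)
      have 1: "\<bar>ld j u - ld j x'\<bar> \<le> K" for j
      proof -
        have "\<bar>(ld j u - ld j x') - (ld 0 u - ld 0 x')\<bar> \<le> K * \<bar>F j x' - F 0 x'\<bar>"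
          by (rule distortion[OF x' btw])
        also have "\<dots> \<le> K * 1"
          using F_in x' K_nonneg unfolding F_0 by (intro mult_left_mono abs_diff_le_1)
        finally show ?thesis by simp
      qed
      have "s * x \<le> s * x'"
        using s F_mono_index[of x 0 "int M"] F_antimono_index[of x 0 "int M"] by (auto simp: x'_def)
      note IH = Suc.IH[of x', OF this]
      have 2: "\<bar>ld j x' - ld j x\<bar> \<le> K * real M" for j
        using IH by (simp add: x'_def)
      have 3: "(\<lambda>n. (ld (int n) x' - ld (int n) x) - (ld (- int n) x' - ld (- int n) x)) \<longlonglongrightarrow> 0"
        using IH by (simp add: x'_def)
      have "\<bar>ld j u - ld j x\<bar> \<le> K * real (Suc M)" for j
        using 1[of j] 2[of j] by (simp add: algebra_simps abs_le_iff)
      moreover have "(\<lambda>n. (ld (int n) u - ld (int n) x) - (ld (- int n) u - ld (- int n) x)) \<longlonglongrightarrow> 0"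
        using tendsto_add[OF distortion_limits_step[OF x' btw] 3] by (simp add: algebra_simps)
      ultimately show ?thesis by blast
    qed
  qed
  then show "\<bar>ld j u - ld j x\<bar> \<le> K * real M"
    "(\<lambda>n. (ld (int n) u - ld (int n) x) - (ld (- int n) u - ld (- int n) x)) \<longlonglongrightarrow> 0"
    by auto
qed

text \<open>Orbits converge to fixed points, and [x, y] contains none. So the orbit of x passes y
  after finitely many iterations of f or of its inverse, whichever moves x to the right.\<close>

lemma distortion_limits:
  assumes I: "x \<in> {0..1}" "y \<in> {0..1}" and xy: "x < y" and nf: "\<And>q. q \<in> {x..y} \<Longrightarrow> F 1 q \<noteq> q"
  obtains B where "\<And>u j. u \<in> {x..y} \<Longrightarrow> \<bar>ld j u - ld j x\<bar> \<le> B"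
    "\<And>u. u \<in> {x..y} \<Longrightarrow> (\<lambda>n. (ld (int n) u - ld (int n) x) - (ld (- int n) u - ld (- int n) x)) \<longlonglongrightarrow> 0"
proof -
  have escape: "\<exists>M. y \<le> F (s * int M) x" if s: "s = 1 \<or> s = -1" and ge: "\<And>n. x \<le> F (s * int n) x" for s
  proof (rule ccontr)
    assume "\<nexists>M. y \<le> F (s * int M) x"
    then have lt: "F (s * int M) x \<le> y" for M by (meson linear)
    obtain p where p: "p \<in> {0..1}" "F 1 p = p" "(\<lambda>n. F (s * int n) x) \<longlonglongrightarrow> p"
      using orbit_tendsto[OF I(1) s] .
    have "x \<le> p" "p \<le> y"
      using LIMSEQ_le_const[OF p(3)] LIMSEQ_le_const2[OF p(3)] ge lt by auto
    then show False using nf p by auto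
  qed
  show thesis
  proof (cases "x \<le> F 1 x")
    case True
    then obtain M where M: "y \<le> F (int M) x"
      using escape[of 1] F_mono_index[of x 0] by auto
    show thesis
      by (rule that[of "K * real M"]) (use M True distortion_limits_chain[OF I(1), of 1 _ M] in auto)
  next
    case False
    then obtain M where M: "y \<le> F (- int M) x"
      using escape[of "-1"] F_antimono_index[of x _ 0] by auto
    \<comment> \<open>The chain lemma follows forward orbits only. As points move to the left here,
      the chain starts from y, and the passage from base point y to base point x doubles the
      constant.\<close>
    then have "F (int M) y \<le> F (int M) (F (- int M) x)" by (simp only: F_le_iff)
    then have M': "F (int M) y \<le> x" by simp
    have y: "F 1 y \<le> y"
      using F_mono_index[of y 0 "int M"] M' xy by force
    have 1: "\<bar>ld j u - ld j y\<bar> \<le> K * real M" if "u \<in> {x..y}" for u j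
      using distortion_limits_chain(1)[OF I(2), of "-1" u M] y M' that by simp
    have 2: "(\<lambda>n. (ld (int n) u - ld (int n) y) - (ld (- int n) u - ld (- int n) y)) \<longlonglongrightarrow> 0" if "u \<in> {x..y}" for u
      using distortion_limits_chain(2)[OF I(2), of "-1" u M] y M' that by simp
    show thesis
    proof (rule that[of "K * real M + K * real M"])
      fix u j assume u: "u \<in> {x..y}"
      show "\<bar>ld j u - ld j x\<bar> \<le> K * real M + K * real M"
        using 1[OF u, of j] 1[of x j] xy by (simp add: abs_le_iff)
      show "(\<lambda>n. (ld (int n) u - ld (int n) x) - (ld (- int n) u - ld (- int n) x)) \<longlonglongrightarrow> 0"
        using tendsto_diff[OF 2[OF u] 2[of x]] xy by (simp add: algebra_simps)
    qed
  qed
qed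

text \<open>Dividing by Df^j(x) gives k = e(y) / w^2, where w is the integral of e over [x, y]. The
  functions e are bounded above by exp B and have pointwise equal limits at both ends, so dominated
  convergence carries the equality over to w. The lower bound exp (-B) keeps w away from 0.\<close>

lemma k_diff_tendsto_0_same_component:
  assumes I: "x \<in> {0..1}" "y \<in> {0..1}" and xy: "x < y" and nf: "\<And>q. q \<in> {x..y} \<Longrightarrow> F 1 q \<noteq> q"
  shows "(\<lambda>n. k (int n) x y - k (- int n) x y) \<longlonglongrightarrow> 0"
proof -
  obtain B where B: "\<And>u j. u \<in> {x..y} \<Longrightarrow> \<bar>ld j u - ld j x\<bar> \<le> B"
    and lim: "\<And>u. u \<in> {x..y} \<Longrightarrow> (\<lambda>n. (ld (int n) u - ld (int n) x) - (ld (- int n) u - ld (- int n) x)) \<longlonglongrightarrow> 0"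
    using distortion_limits[OF assms] by blast
  define e where "e = (\<lambda>j u. DF j u / DF j x)"
  have e: "e j u = exp (ld j u - ld j x)" for j u by (simp add: e_def exp_diff exp_ld)
  have e_le: "e j u \<le> exp B" and e_ge: "exp (- B) \<le> e j u" if "u \<in> {x..y}" for j u
    using B[OF that, of j] by (auto simp: e abs_le_iff)
  have e_lim: "(\<lambda>n. e (int n) u - e (- int n) u) \<longlonglongrightarrow> 0" if u: "u \<in> {x..y}" for u
  proof (rule Lim_null_comparison)
    define r where "r = (\<lambda>n. (ld (int n) u - ld (int n) x) - (ld (- int n) u - ld (- int n) x))"
    have "(\<lambda>n. exp B * \<bar>exp (r n) - 1\<bar>) \<longlonglongrightarrow> exp B * \<bar>exp 0 - 1\<bar>"
      using lim[OF u] unfolding r_def[symmetric] by (intro tendsto_intros)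
    then show "(\<lambda>n. exp B * \<bar>exp (r n) - 1\<bar>) \<longlonglongrightarrow> 0" by simp
    have "\<bar>e (int n) u - e (- int n) u\<bar> \<le> exp B * \<bar>exp (r n) - 1\<bar>" for n
    proof -
      have "e (int n) u - e (- int n) u = e (- int n) u * (exp (r n) - 1)"
        by (simp add: e r_def algebra_simps flip: exp_add)
      then show ?thesis
        using e_le[OF u, of "- int n"] by (simp add: abs_mult e mult_right_mono)
    qed
    then show "\<forall>\<^sub>F n in sequentially. norm (e (int n) u - e (- int n) u) \<le> exp B * \<bar>exp (r n) - 1\<bar>"
      by simp
  qed
  define w where "w = (\<lambda>j. (F j y - F j x) / DF j x)"
  have sub: "{x..y} \<subseteq> {0..1}" using I by auto
  have int: "(e j has_integral w j) {x..y}" for j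
  proof -
    have "((\<lambda>u. F j u / DF j x) has_real_derivative e j u) (at u within {x..y})" if "u \<in> {x..y}" for u
      unfolding e_def using that sub
      by (intro DERIV_cdivide has_field_derivative_subset[OF DF]) auto
    then have "(e j has_integral F j y / DF j x - F j x / DF j x) {x..y}"
      using xy by (intro fundamental_theorem_of_calculus)
         (auto simp: has_real_derivative_iff_has_vector_derivative)
    then show ?thesis by (simp add: w_def diff_divide_distrib)
  qed
  have "(\<lambda>n. integral {x..y} (\<lambda>u. e (int n) u - e (- int n) u)) \<longlonglongrightarrow> integral {x..y} (\<lambda>u. 0)"
  proof (rule dominated_convergence(2))
    show "(\<lambda>u. e (int n) u - e (- int n) u) integrable_on {x..y}" for n
      using int by (intro integrable_diff) (auto simp: integrable_on_def)
    show "(\<lambda>u. exp B) integrable_on {x..y}" by (rule integrable_const_ivl)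
    show "norm (e (int n) u - e (- int n) u) \<le> exp B" if "u \<in> {x..y}" for n u
      using e_le[OF that, of "int n"] e_le[OF that, of "- int n"]
        exp_gt_zero[of "ld (int n) u - ld (int n) x"] exp_gt_zero[of "ld (- int n) u - ld (- int n) x"]
      unfolding e real_norm_def by linarith
  qed (use e_lim in auto)
  moreover have "integral {x..y} (\<lambda>u. e (int n) u - e (- int n) u) = w (int n) - w (- int n)" for n
    by (rule integral_unique) (intro has_integral_diff int)
  ultimately have w_lim: "(\<lambda>n. w (int n) - w (- int n)) \<longlonglongrightarrow> 0" by simp
  have w_ge: "exp (- B) * (y - x) \<le> w j" for j
    using has_integral_le[OF has_integral_const_real[of "exp (- B)" x y] int, of j] e_ge xy
    by (simp add: mult.commute)
  have w_le: "w j \<le> exp B * (y - x)" for j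
    using has_integral_le[OF int has_integral_const_real[of "exp B" x y], of j] e_le xy
    by (simp add: mult.commute)
  have k: "k j x y = e j y / (w j)\<^sup>2" for j
    by (simp add: k_def e_def w_def power2_eq_square field_simps)
  show ?thesis
    unfolding k
  proof (rule tendsto_diff_quotient_sq)
    show "(\<lambda>n. e (int n) y - e (- int n) y) \<longlonglongrightarrow> 0" using xy by (intro e_lim) auto
    show "\<bar>e (- int n) y\<bar> \<le> exp B" for n using e_le[of y "- int n"] xy by (simp add: e)
    show "0 < exp (- B) * (y - x)" using xy by simp
  qed (rule w_lim w_ge w_le)+
qed

section \<open>Derivatives at fixed points and pairs separated by a fixed point\<close>

text \<open>The orbit approaches its forward limit p1, which forces Df(p1) \<le> 1, and leaves its
  backward limit p2, which forces Df(p2) \<ge> 1. Equality of the distortion limits for u = f(x)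
  says Df(p1) = Df(p2), so both are 1.\<close>

lemma limit_parabolic:
  assumes x: "x \<in> {0..1}" and nf: "F 1 x \<noteq> x" and s: "s = 1 \<or> s = (-1::int)"
    and p: "(\<lambda>n. F (s * int n) x) \<longlonglongrightarrow> p"
  shows "DF 1 p = 1"
proof -
  obtain p1 where p1: "p1 \<in> {0..1}" "F 1 p1 = p1" "(\<lambda>n. F (int n) x) \<longlonglongrightarrow> p1"
    using orbit_tendsto[OF x, of 1] by auto
  obtain p2 where p2: "p2 \<in> {0..1}" "F 1 p2 = p2" "(\<lambda>n. F (- int n) x) \<longlonglongrightarrow> p2"
    using orbit_tendsto[OF x, of "-1"] by auto
  obtain t :: real where t: "t = 1 \<or> t = -1" "\<And>i j. i \<le> j \<Longrightarrow> t * F i x \<le> t * F j x"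
    using obtain_direction by blast
  have cont: "continuous_on {0..1} (ld 1)"
    unfolding ld_def using DF_cont by (intro continuous_intros) auto
  \<comment> \<open>Two expansions of log Df^(j+1)(x). The term at x cancels when the two ends are
    compared.\<close>
  have "ld j (F 1 x) - ld j x = ld 1 (F j x) - ld 1 x" for j
    using ld_add[of j 1 x] ld_add[of 1 j x] by (simp add: add.commute)
  moreover have "(\<lambda>n. (ld (int n) (F 1 x) - ld (int n) x) - (ld (- int n) (F 1 x) - ld (- int n) x)) \<longlonglongrightarrow> 0"
    by (rule distortion_limits_step[OF x]) auto
  ultimately have "(\<lambda>n. ld 1 (F (int n) x) - ld 1 (F (- int n) x)) \<longlonglongrightarrow> 0" by simp
  moreover have "(\<lambda>n. ld 1 (F (int n) x) - ld 1 (F (- int n) x)) \<longlonglongrightarrow> ld 1 p1 - ld 1 p2"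
    using F_in[OF x] by (intro tendsto_diff continuous_on_tendsto_compose[OF cont] p1 p2) auto
  ultimately have "ld 1 p1 - ld 1 p2 = 0" by (rule LIMSEQ_unique[symmetric])
  then have eq: "DF 1 p1 = DF 1 p2" using exp_ld[of 1 p1] exp_ld[of 1 p2] by simp
  have 1: "DF 1 p1 \<le> 1"
  proof (rule LIMSEQ_le_const2)
    show "(\<lambda>n. (F 1 (F (int n) x) - p1) / (F (int n) x - p1)) \<longlonglongrightarrow> DF 1 p1"
      using p1 F_in[OF x] F_not_fixed[OF nf] by (intro ratio_tendsto) auto
    have "(F 1 (F (int n) x) - p1) / (F (int n) x - p1) \<le> 1" for n
    proof -
      have "F 1 (F (int n) x) = F (int (Suc n)) x" using F_add[of 1 "int n" x] by simp
      moreover have "t * F (int n) x \<le> t * F (int (Suc n)) x" by (intro t) simp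
      moreover have "t * F (int (Suc n)) x \<le> t * p1"
        by (rule LIMSEQ_le_const[OF tendsto_mult_left[OF p1(3)]]) (intro exI[of _ "Suc n"] allI impI t, simp)
      moreover have "F (int n) x \<noteq> p1" using F_not_fixed[OF nf p1(2)] .
      ultimately show ?thesis using t(1) by (auto simp: divide_le_eq)
    qed
    then show "\<exists>N. \<forall>n\<ge>N. (F 1 (F (int n) x) - p1) / (F (int n) x - p1) \<le> 1" by blast
  qed
  have 2: "DF 1 p2 \<ge> 1"
  proof (rule LIMSEQ_le_const)
    show "(\<lambda>n. (F 1 (F (- int n) x) - p2) / (F (- int n) x - p2)) \<longlonglongrightarrow> DF 1 p2"
      using p2 F_in[OF x] F_not_fixed[OF nf] by (intro ratio_tendsto) auto
    have "1 \<le> (F 1 (F (- int n) x) - p2) / (F (- int n) x - p2)" for n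
    proof -
      have "F 1 (F (- int n) x) = F (1 - int n) x" using F_add[of 1 "- int n" x] by simp
      moreover have "t * F (- int n) x \<le> t * F (1 - int n) x" by (intro t) simp
      moreover have "t * p2 \<le> t * F (- int n) x"
        by (rule LIMSEQ_le_const2[OF tendsto_mult_left[OF p2(3)]]) (intro exI[of _ n] allI impI t, simp)
      moreover have "F (- int n) x \<noteq> p2" using F_not_fixed[OF nf p2(2)] .
      ultimately show ?thesis using t(1) by (auto simp: le_divide_eq)
    qed
    then show "\<exists>N. \<forall>n\<ge>N. 1 \<le> (F 1 (F (- int n) x) - p2) / (F (- int n) x - p2)" by blast
  qed
  have "p = p1 \<or> p = p2"
    using s p LIMSEQ_unique[OF _ p1(3), of p] LIMSEQ_unique[OF _ p2(3), of p] by auto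
  then show ?thesis using 1 2 eq by auto
qed

text \<open>A fixed point q with Df(q) \<noteq> 1 would be isolated among the fixed points. A nearby
  point would then converge to q under forward or backward iteration, and
  \<open>limit_parabolic\<close> would give Df(q) = 1.\<close>

lemma fixed_parabolic:
  assumes q: "q \<in> {0..1}" "F 1 q = q"
  shows "DF j q = 1"
proof -
  have "DF 1 q = 1"
  proof (rule ccontr)
    assume ne: "DF 1 q \<noteq> 1"
    have "((\<lambda>z. (F 1 z - F 1 q) / (z - q)) \<longlongrightarrow> DF 1 q) (at q within {0..1})"
      using DF[OF q(1), of 1] by (simp add: has_field_derivative_iff)
    then have "\<forall>\<^sub>F z in at q within {0..1}. (F 1 z - F 1 q) / (z - q) \<noteq> 1"
      using ne tendsto_imp_eventually_ne by blast
    then obtain d where d: "d > 0" "\<And>z. z \<in> {0..1} \<Longrightarrow> z \<noteq> q \<Longrightarrow> dist z q < d \<Longrightarrow> (F 1 z - F 1 q) / (z - q) \<noteq> 1"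
      unfolding eventually_at by blast
    have nf: "F 1 z \<noteq> z" if "z \<in> {0..1}" "z \<noteq> q" "\<bar>z - q\<bar> < d" for z
      using d(2)[of z] that q(2) by (auto simp: dist_real_def)
    \<comment> \<open>A point of [0,1] within d/2 of q, to its right unless q is the endpoint
      1.\<close>
    define x where "x = (if q < 1 then q + min (d/2) (1 - q) else q - min (d/2) q)"
    have x: "x \<in> {0..1}" "x \<noteq> q" "\<bar>x - q\<bar> < d"
      using q d(1) by (auto simp: x_def min_def)
    have between: "p = q" if "F 1 p = p" "x \<le> p \<and> p \<le> q \<or> q \<le> p \<and> p \<le> x" for p
    proof (rule ccontr)
      assume "p \<noteq> q"
      moreover have "p \<in> {0..1}" "\<bar>p - q\<bar> < d" using that x q by auto
      ultimately show False using nf that(1) by blast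
    qed
    have lim: "(\<lambda>n. F (s * int n) x) \<longlonglongrightarrow> q"
      if s: "s = 1 \<or> s = -1" and le: "\<And>n. x < q \<and> x \<le> F (s * int n) x \<or> q < x \<and> F (s * int n) x \<le> x" for s
    proof -
      obtain p where p: "p \<in> {0..1}" "F 1 p = p" "(\<lambda>n. F (s * int n) x) \<longlonglongrightarrow> p"
        using orbit_tendsto[OF x(1) s] .
      have Fq: "F (s * int n) q = q" for n by (rule F_fixed[OF q(2)])
      have "x \<le> p \<and> p \<le> q \<or> q \<le> p \<and> p \<le> x"
      proof (cases "x < q")
        case True
        then have "F (s * int n) x \<le> q" for n using F_less[of x q "s * int n"] Fq by simp
        moreover have "x \<le> F (s * int n) x" for n using le[of n] True by auto
        ultimately show ?thesis
          using LIMSEQ_le_const[OF p(3), of x] LIMSEQ_le_const2[OF p(3), of q] by auto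
      next
        case False
        then have "q < x" using x by simp
        then have "q \<le> F (s * int n) x" for n using F_less[of q x "s * int n"] Fq by simp
        moreover have "F (s * int n) x \<le> x" for n using le[of n] False by auto
        ultimately show ?thesis
          using LIMSEQ_le_const[OF p(3), of q] LIMSEQ_le_const2[OF p(3), of x] by auto
      qed
      then show ?thesis using between p by auto
    qed
    have "\<exists>s. (s = 1 \<or> s = (-1::int)) \<and> (\<lambda>n. F (s * int n) x) \<longlonglongrightarrow> q"
    proof (cases "x < q \<longleftrightarrow> x \<le> F 1 x")
      case True
      then show ?thesis
        using lim[of 1] x F_mono_index[of x 0] F_antimono_index[of x 0] by (intro exI[of _ 1]) force
    next
      case False
      then show ?thesis
        using lim[of "-1"] x F_mono_index[of x _ 0] F_antimono_index[of x _ 0] by (intro exI[of _ "-1"]) force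
    qed
    then show False using limit_parabolic[OF x(1) nf[OF x]] ne by blast
  qed
  note 1 = this
  show ?thesis
  proof (induction j rule: int_induct[where k = 0])
    case (step1 i)
    then show ?case using DF_add[of i 1 q] q 1 by simp
  next
    case (step2 i)
    then show ?case using DF_add[of "i - 1" 1 q] q 1 by simp
  qed simp
qed

text \<open>By \<open>DF_le_displacement\<close> the quotient is at most a constant times |f(z) - z|
  / |z - q| with z on the orbit. If z tends to q, this tends to |Df(q) - 1| = 0; if z tends to
  another fixed point, the numerator tends to 0 and the denominator does not.\<close>

lemma DF_over_distance_tendsto_0:
  assumes x: "x \<in> {0..1}" and nf: "F 1 x \<noteq> x" and s: "s = 1 \<or> s = (-1::int)"
    and q: "q \<in> {0..1}" "F 1 q = q"
  shows "(\<lambda>n. DF (s * int n) x / \<bar>F (s * int n) x - q\<bar>) \<longlonglongrightarrow> 0"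
proof -
  define z where "z = (\<lambda>n. F (s * int n) x)"
  have zI: "z n \<in> {0..1}" for n unfolding z_def by (rule F_in[OF x])
  obtain p where p: "p \<in> {0..1}" "F 1 p = p" "z \<longlonglongrightarrow> p"
    using orbit_tendsto[OF x s] unfolding z_def by blast
  have zq: "z n \<noteq> q" for n unfolding z_def using F_not_fixed[OF nf q(2)] .
  have "(\<lambda>n. (F 1 (z n) - z n) / (z n - q)) \<longlonglongrightarrow> 0"
  proof (cases "p = q")
    case True
    have "(\<lambda>n. (F 1 (z n) - q) / (z n - q) - 1) \<longlonglongrightarrow> DF 1 q - 1"
      using zI zq p True by (intro tendsto_intros ratio_tendsto q) auto
    moreover have "(F 1 (z n) - q) / (z n - q) - 1 = (F 1 (z n) - z n) / (z n - q)" for n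
      using zq[of n] by (simp add: field_simps)
    ultimately show ?thesis using fixed_parabolic[OF q] by simp
  next
    case False
    have "(\<lambda>n. F 1 (z n)) \<longlonglongrightarrow> F 1 p"
      by (rule continuous_on_tendsto_compose[OF F_cont p(3,1)]) (use zI in auto)
    then have "(\<lambda>n. (F 1 (z n) - z n) / (z n - q)) \<longlonglongrightarrow> (F 1 p - p) / (p - q)"
      using p False by (intro tendsto_intros) auto
    then show ?thesis using p by simp
  qed
  then have "(\<lambda>n. exp K / \<bar>F 1 x - x\<bar> * \<bar>(F 1 (z n) - z n) / (z n - q)\<bar>) \<longlonglongrightarrow> exp K / \<bar>F 1 x - x\<bar> * \<bar>0\<bar>"
    using nf by (intro tendsto_intros) auto
  then have L: "(\<lambda>n. exp K / \<bar>F 1 x - x\<bar> * \<bar>(F 1 (z n) - z n) / (z n - q)\<bar>) \<longlonglongrightarrow> 0" by simp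
  have "norm (DF (s * int n) x / \<bar>F (s * int n) x - q\<bar>) \<le> exp K / \<bar>F 1 x - x\<bar> * \<bar>(F 1 (z n) - z n) / (z n - q)\<bar>" for n
  proof -
    have "F (s * int n + 1) x = F 1 (z n)" using F_add[of 1 "s * int n" x] by (simp add: z_def add.commute)
    then have "DF (s * int n) x \<le> exp K / \<bar>F 1 x - x\<bar> * \<bar>F 1 (z n) - z n\<bar>"
      using DF_le_displacement[OF x nf, of "s * int n"] by (simp add: z_def)
    then have "DF (s * int n) x / \<bar>z n - q\<bar> \<le> exp K / \<bar>F 1 x - x\<bar> * \<bar>F 1 (z n) - z n\<bar> / \<bar>z n - q\<bar>"
      by (rule divide_right_mono) simp
    then show ?thesis by (simp add: z_def abs_divide)
  qed
  then show ?thesis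
    by (intro Lim_null_comparison[OF _ L]) simp
qed

text \<open>Suppose a fixed point q separates x and y. If y moves, |f^j(x) - f^j(y)| is at least
  each of the distances to q, so k is at most a product of two quotients that tend to 0. If y is
  fixed, one factor tends to 0 and the other, 1 / |f^j(x) - y|, stays bounded because by
  \<open>lim\<close> the orbit of x does not converge to y.\<close>

lemma k_diff_tendsto_0:
  assumes x: "x \<in> {0..1}" and nf: "F 1 x \<noteq> x" and y: "y \<in> {0..1}" "y \<noteq> x"
    and lim: "\<not> (\<lambda>n. F (int n) x) \<longlonglongrightarrow> y" "\<not> (\<lambda>n. F (- int n) x) \<longlonglongrightarrow> y"
  shows "(\<lambda>n. k (int n) x y - k (- int n) x y) \<longlonglongrightarrow> 0"
proof (cases "\<exists>q. F 1 q = q \<and> (x \<le> q \<and> q \<le> y \<or> y \<le> q \<and> q \<le> x)")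
  case True
  then obtain q where q: "F 1 q = q" "x \<le> q \<and> q \<le> y \<or> y \<le> q \<and> q \<le> x" by blast
  have qI: "q \<in> {0..1}" using q x y by auto
  have "(\<lambda>n. k (s * int n) x y) \<longlonglongrightarrow> 0" if s: "s = 1 \<or> s = -1" for s
  proof (cases "F 1 y = y")
    case yf: True
    obtain p where p: "p \<in> {0..1}" "F 1 p = p" "(\<lambda>n. F (s * int n) x) \<longlonglongrightarrow> p"
      using orbit_tendsto[OF x s] .
    have "p \<noteq> y" using p(3) s lim by auto
    then have "(\<lambda>n. DF (s * int n) x / \<bar>F (s * int n) x - y\<bar> * (1 / \<bar>F (s * int n) x - y\<bar>)) \<longlonglongrightarrow> 0 * (1 / \<bar>p - y\<bar>)"
      by (intro tendsto_mult DF_over_distance_tendsto_0[OF x nf s y(1) yf] tendsto_intros p) auto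
    moreover have "DF (s * int n) x / \<bar>F (s * int n) x - y\<bar> * (1 / \<bar>F (s * int n) x - y\<bar>) = k (s * int n) x y" for n
      using fixed_parabolic[OF y(1) yf] F_fixed[OF yf] by (simp add: k_def power2_eq_square)
    ultimately show ?thesis by simp
  next
    case ynf: False
    have P: "(\<lambda>n. (DF (s * int n) x / \<bar>F (s * int n) x - q\<bar>) * (DF (s * int n) y / \<bar>F (s * int n) y - q\<bar>)) \<longlonglongrightarrow> 0"
      using tendsto_mult[OF DF_over_distance_tendsto_0[OF x nf s qI q(1)] DF_over_distance_tendsto_0[OF y(1) ynf s qI q(1)]]
      by simp
    have "norm (k (s * int n) x y) \<le> (DF (s * int n) x / \<bar>F (s * int n) x - q\<bar>) * (DF (s * int n) y / \<bar>F (s * int n) y - q\<bar>)" for n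
    proof -
      have Fq: "F (s * int n) q = q" by (rule F_fixed[OF q(1)])
      have ne: "F (s * int n) x \<noteq> q" "F (s * int n) y \<noteq> q"
        using F_not_fixed nf ynf q(1) by auto
      have btw: "F (s * int n) x \<le> q \<and> q \<le> F (s * int n) y \<or> F (s * int n) y \<le> q \<and> q \<le> F (s * int n) x"
        using q(2) F_le_iff Fq by metis
      have "\<bar>F (s * int n) x - q\<bar> * \<bar>F (s * int n) y - q\<bar> \<le> \<bar>F (s * int n) x - F (s * int n) y\<bar> * \<bar>F (s * int n) x - F (s * int n) y\<bar>"
        using btw by (intro mult_mono) auto
      then have "DF (s * int n) x * DF (s * int n) y / (F (s * int n) x - F (s * int n) y)\<^sup>2
         \<le> DF (s * int n) x * DF (s * int n) y / (\<bar>F (s * int n) x - q\<bar> * \<bar>F (s * int n) y - q\<bar>)"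
        using ne y by (intro divide_left_mono) (auto simp: power2_eq_square zero_less_mult_iff)
      then show ?thesis by (simp add: k_def)
    qed
    then show ?thesis by (intro Lim_null_comparison[OF _ P]) simp
  qed
  from tendsto_diff[OF this[of 1] this[of "-1"]] show ?thesis by simp
next
  case False
  show ?thesis
  proof (cases "x < y")
    case True
    then show ?thesis using False x y by (intro k_diff_tendsto_0_same_component) auto
  next
    case ge: False
    then have "(\<lambda>n. k (int n) y x - k (- int n) y x) \<longlonglongrightarrow> 0"
      using False x y by (intro k_diff_tendsto_0_same_component) auto
    then show ?thesis by (simp add: k_commute[of _ y x])
  qed
qed

end

section \<open>Unfolding the norm along orbits\<close>

lemma borel_measurable_nn_integral_int:
  fixes g :: "int \<Rightarrow> 'a \<Rightarrow> ennreal"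
  assumes "\<And>j. g j \<in> borel_measurable M"
  shows "(\<lambda>x. \<integral>\<^sup>+j. g j x \<partial>count_space UNIV) \<in> borel_measurable M"
proof (rule sigma_finite_measure.borel_measurable_nn_integral[OF sigma_finite_measure_count_space])
  have "(\<lambda>(j, x). g j x) \<in> borel_measurable (count_space UNIV \<Otimes>\<^sub>M M)"
    by (rule measurable_pair_measure_countable1) (use assms in auto)
  from measurable_pair_swap[OF this]
  show "(\<lambda>(x, j). g j x) \<in> borel_measurable (M \<Otimes>\<^sub>M count_space UNIV)"
    by simp
qed

lemma AE_not_on_graph:
  fixes h :: "real \<Rightarrow> real"
  assumes [measurable]: "h \<in> borel_measurable borel"
  shows "AE p in lborel \<Otimes>\<^sub>M lborel. snd p \<noteq> h (fst p)"
proof (rule lborel_pair.AE_pair_measure)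
  show "{p \<in> space (lborel \<Otimes>\<^sub>M lborel). snd p \<noteq> h (fst p)} \<in> sets (lborel \<Otimes>\<^sub>M lborel)"
    by measurable
qed (simp add: AE_lborel_singleton)

section \<open>Measurability and change of variables\<close>

context interval_action begin

lemma F_measurable [measurable]: "F j \<in> borel_measurable borel"
  by (rule borel_measurable_mono) (simp add: mono_def)

lemma DF_measurable [measurable]: "DF j \<in> borel_measurable borel"
proof -
  have "(\<lambda>x. indicator {0..1} x *\<^sub>R DF j x) \<in> borel_measurable borel"
    by (rule borel_measurable_continuous_on_indicator) (auto simp: DF_cont)
  then have "(\<lambda>x. indicator {0..1} x *\<^sub>R DF j x + indicator (- {0..1}) x) \<in> borel_measurable borel"
    by measurable
  moreover have "(\<lambda>x. indicator {0..1} x *\<^sub>R DF j x + indicator (- {0..1}) x) = DF j"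
    by (rule ext) (auto simp: indicator_def DF_outside)
  ultimately show ?thesis by simp
qed

lemma F_cont_UNIV: "continuous_on UNIV (F j)"
proof (rule continuous_onI_mono)
  have "range (F j) = UNIV" by (metis F_inverse(2) surjI)
  then show "open (range (F j))" by simp
qed simp

lemma DF_at:
  assumes "x \<noteq> 0" "x \<noteq> 1"
  shows "(F j has_real_derivative DF j x) (at x)"
proof (cases "x \<in> {0..1}")
  case True
  then have "x \<in> interior {0..1}" using assms by (auto simp: interior_atLeastAtMost_real)
  then show ?thesis using DF[OF True] at_within_interior by metis
next
  case False
  have "((\<lambda>x. x) has_real_derivative 1) (at x)" by (rule DERIV_ident)
  then have "(F j has_real_derivative 1) (at x)"
    by (rule has_field_derivative_transform_within_open[where S = "- {0..1}"])
       (use False in \<open>auto simp: F_outside closed_atLeastAtMost open_Compl\<close>)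
  then show ?thesis using DF_outside[OF False] by simp
qed

text \<open>The push-forward under f^j of the measure with density Df^j gives each interval its
  length, hence is Lebesgue measure. The extended map may have corners at 0 and 1, so the
  fundamental theorem of calculus is used with these two points excepted.\<close>

lemma nn_integral_F:
  assumes [measurable]: "G \<in> borel_measurable borel"
  shows "(\<integral>\<^sup>+x. G (F j x) * ennreal (DF j x) \<partial>lborel) = (\<integral>\<^sup>+x. G x \<partial>lborel)"
proof -
  define M where "M = distr (density lborel (\<lambda>x. ennreal (DF j x))) borel (F j)"
  have "lborel = M"
  proof (rule lborel_eqI)
    fix l u :: real
    assume "\<And>b. b \<in> Basis \<Longrightarrow> l \<bullet> b \<le> u \<bullet> b"
    then have lu: "l \<le> u" by simp
    define a where "a = F (- j) l"
    define b where "b = F (- j) u"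
    have ab: "F j a = l" "F j b = u" "a \<le> b" using lu by (simp_all add: a_def b_def)
    have vimage: "F j -` {l<..<u} = {a<..<b}" using ab by (auto simp flip: ab(1,2))
    have "(DF j has_integral F j b - F j a) {a..b}"
    proof (rule fundamental_theorem_of_calculus_strong[where S = "{0, 1}"])
      show "(F j has_vector_derivative DF j x) (at x)" if "x \<in> {a..b} - {0, 1}" for x
        using DF_at[of x] that by (simp add: has_real_derivative_iff_has_vector_derivative)
    qed (use ab in \<open>auto intro: continuous_on_subset[OF F_cont_UNIV]\<close>)
    then have "(DF j has_integral F j b - F j a) {a<..<b}"
      by (simp add: has_integral_Icc_iff_Ioo)
    then have "(\<integral>\<^sup>+x. indicator {a<..<b} x * ennreal (DF j x) \<partial>lborel) = ennreal (F j b - F j a)"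
      using nn_integral_has_integral_lebesgue'[of "{a<..<b}" "DF j"] by (simp add: mult.commute)
    then have "emeasure M {l<..<u} = ennreal (u - l)"
      using ab by (simp add: M_def emeasure_distr vimage emeasure_density mult.commute)
    then show "emeasure M (box l u) = ennreal (\<Prod>b\<in>Basis. (u - l) \<bullet> b)"
      by (simp add: box_real)
  qed (simp add: M_def)
  then have "(\<integral>\<^sup>+x. G x \<partial>lborel) = (\<integral>\<^sup>+x. G x \<partial>M)" by simp
  also have "\<dots> = (\<integral>\<^sup>+x. G (F j x) * ennreal (DF j x) \<partial>lborel)"
    by (simp add: M_def nn_integral_distr nn_integral_density mult.commute)
  finally show ?thesis by simp
qed

lemma nn_integral_F_pair:
  assumes [measurable]: "G \<in> borel_measurable (borel \<Otimes>\<^sub>M borel)"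
  shows "(\<integral>\<^sup>+p. G (F j (fst p), F j (snd p)) * (ennreal (DF j (fst p)) * ennreal (DF j (snd p))) \<partial>(lborel \<Otimes>\<^sub>M lborel))
    = (\<integral>\<^sup>+p. G p \<partial>(lborel \<Otimes>\<^sub>M lborel))"
proof -
  have [measurable]: "(\<lambda>y. G (x, y)) \<in> borel_measurable borel" for x by measurable
  have m: "(\<lambda>x. \<integral>\<^sup>+y. G (x, y) \<partial>lborel) \<in> borel_measurable borel"
    by measurable
  have "(\<integral>\<^sup>+p. G (F j (fst p), F j (snd p)) * (ennreal (DF j (fst p)) * ennreal (DF j (snd p))) \<partial>(lborel \<Otimes>\<^sub>M lborel))
      = (\<integral>\<^sup>+x. \<integral>\<^sup>+y. G (F j x, F j y) * (ennreal (DF j x) * ennreal (DF j y)) \<partial>lborel \<partial>lborel)"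
    by (subst lborel.nn_integral_fst[symmetric]) simp_all
  also have "\<dots> = (\<integral>\<^sup>+x. (\<integral>\<^sup>+y. G (F j x, F j y) * ennreal (DF j y) \<partial>lborel) * ennreal (DF j x) \<partial>lborel)"
    by (intro nn_integral_cong, subst nn_integral_multc[symmetric]) (simp_all add: mult_ac)
  also have "\<dots> = (\<integral>\<^sup>+x. (\<integral>\<^sup>+y. G (F j x, y) \<partial>lborel) * ennreal (DF j x) \<partial>lborel)"
    by (simp add: nn_integral_F[where G = "\<lambda>y. G (F j _, y)"])
  also have "\<dots> = (\<integral>\<^sup>+x. (\<integral>\<^sup>+y. G (x, y) \<partial>lborel) \<partial>lborel)"
    by (rule nn_integral_F[OF m])
  also have "\<dots> = (\<integral>\<^sup>+p. G p \<partial>(lborel \<Otimes>\<^sub>M lborel))"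
    by (subst lborel.nn_integral_fst) simp_all
  finally show ?thesis .
qed

section \<open>A weight in place of a fundamental domain\<close>

text \<open>As orbits are monotone, for a non-fixed x this is the length of the component of the
  complement of the fixed point set that contains x. Written as a sum over the orbit, it is visibly
  invariant and measurable.\<close>

definition \<omega> :: "real \<Rightarrow> ennreal" where
  "\<omega> x = (\<integral>\<^sup>+j. ennreal \<bar>F (j + 1) x - F j x\<bar> \<partial>count_space UNIV)"

text \<open>\<open>W\<close> replaces the indicator of a fundamental domain: it vanishes at fixed points, and
  its values along any other orbit add up to 1.\<close>

definition W :: "real \<Rightarrow> ennreal" where
  "W x = ennreal \<bar>F 1 x - x\<bar> / \<omega> x"

lemma omega_F: "\<omega> (F i x) = \<omega> x"
proof -
  have "\<omega> (F i x) = (\<integral>\<^sup>+j. ennreal \<bar>F ((j + i) + 1) x - F (j + i) x\<bar> \<partial>count_space UNIV)"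
    unfolding \<omega>_def by (simp only: F_add[symmetric] add_ac)
  also have "\<dots> = \<omega> x"
    unfolding \<omega>_def by (rule nn_integral_count_space_shift[of "\<lambda>j. ennreal \<bar>F (j + 1) x - F j x\<bar>"])
  finally show ?thesis .
qed

lemma W_F: "W (F j x) = ennreal \<bar>F (j + 1) x - F j x\<bar> / \<omega> x"
  using F_add[of 1 j x] by (simp add: W_def omega_F add.commute)

text \<open>The displacements along an orbit all have the same sign, so symmetric partial sums
  telescope to the distance of two points of [0,1].\<close>

lemma omega_finite:
  assumes x: "x \<in> {0..1}"
  shows "\<omega> x < \<infinity>"
proof -
  obtain t :: real where t: "t = 1 \<or> t = -1" "\<And>i j. i \<le> j \<Longrightarrow> t * F i x \<le> t * F j x"
    using obtain_direction by blast
  define a where "a = (\<lambda>j. \<bar>F (j + 1) x - F j x\<bar>)"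
  have a: "a j = t * F (j + 1) x - t * F j x" for j
    using t(1) t(2)[of j "j + 1"] by (auto simp: a_def)
  have sum: "(\<Sum>j\<in>{- int n..<int n}. a j) = t * F (int n) x - t * F (- int n) x" for n
  proof (induction n)
    case (Suc n)
    have "{- int (Suc n)..<int (Suc n)} = insert (- int (Suc n)) (insert (int n) {- int n..<int n})" by auto
    then show ?case using Suc by (simp add: a algebra_simps)
  qed simp
  have lim: "(\<lambda>n. \<integral>\<^sup>+j. ennreal (a j) * indicator {- int n..<int n} j \<partial>count_space UNIV) \<longlonglongrightarrow> (\<integral>\<^sup>+j. ennreal (a j) \<partial>count_space UNIV)"
  proof (rule nn_integral_LIMSEQ)
    show "incseq (\<lambda>n j. ennreal (a j) * indicator {- int n..<int n} j)"
      by (auto simp: incseq_def le_fun_def indicator_def)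
    fix j :: int
    have "\<forall>\<^sub>F n in sequentially. ennreal (a j) * indicator {- int n..<int n} j = ennreal (a j)"
      using eventually_gt_at_top[of "nat \<bar>j\<bar>"] by eventually_elim (auto simp: indicator_def)
    then show "(\<lambda>n. ennreal (a j) * indicator {- int n..<int n} j) \<longlonglongrightarrow> ennreal (a j)"
      by (rule tendsto_eventually)
  qed simp
  have "(\<integral>\<^sup>+j. ennreal (a j) * indicator {- int n..<int n} j \<partial>count_space UNIV) \<le> 1" for n
  proof -
    have "(\<integral>\<^sup>+j. ennreal (a j) * indicator {- int n..<int n} j \<partial>count_space UNIV)
        = (\<Sum>j\<in>{- int n..<int n}. ennreal (a j) * indicator {- int n..<int n} j)"
      by (rule nn_integral_count_space') (auto simp: indicator_def)
    also have "\<dots> = (\<Sum>j\<in>{- int n..<int n}. ennreal (a j))"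
      by (intro sum.cong) auto
    also have "\<dots> = ennreal (t * F (int n) x - t * F (- int n) x)"
      by (subst sum_ennreal) (auto simp: a_def sum[unfolded a_def])
    also have "\<dots> \<le> ennreal 1"
      using abs_diff_le_1[OF F_in[OF x] F_in[OF x], of "int n" "- int n"] t(1)
      by (intro ennreal_leI) (auto simp: abs_le_iff)
    finally show ?thesis by simp
  qed
  then have "(\<integral>\<^sup>+j. ennreal (a j) \<partial>count_space UNIV) \<le> 1"
    using Lim_bounded[OF lim, of 0 1] by simp
  then have "\<omega> x \<le> 1" by (simp add: \<omega>_def a_def)
  then show ?thesis by (rule le_less_trans) simp
qed

lemma omega_pos:
  assumes "F 1 x \<noteq> x"
  shows "\<omega> x \<noteq> 0"
proof
  assume "\<omega> x = 0"
  then have "\<forall>j. \<bar>F (j + 1) x - F j x\<bar> = 0"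
    by (simp add: \<omega>_def nn_integral_0_iff_AE AE_count_space)
  from spec[OF this, of 0] assms show False by simp
qed

lemma sum_W:
  assumes x: "x \<in> {0..1}"
  shows "(\<integral>\<^sup>+j. W (F j x) \<partial>count_space UNIV) = (if F 1 x = x then 0 else 1)"
proof (cases "F 1 x = x")
  case True
  then show ?thesis using F_fixed[OF True] by (simp add: W_def)
next
  case False
  have "(\<integral>\<^sup>+j. W (F j x) \<partial>count_space UNIV) = \<omega> x / \<omega> x"
    unfolding W_F by (subst nn_integral_divide) (auto simp: \<omega>_def)
  also have "\<dots> = 1"
    using omega_pos[OF False] omega_finite[OF x] by (simp add: ennreal_divide_self less_top)
  finally show ?thesis using False by simp
qed

lemma omega_measurable [measurable]: "\<omega> \<in> borel_measurable borel"
proof -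
  have "\<omega> = (\<lambda>x. \<integral>\<^sup>+j. ennreal \<bar>F (j + 1) x - F j x\<bar> \<partial>count_space UNIV)"
    by (simp add: \<omega>_def fun_eq_iff)
  moreover have "(\<lambda>x. \<integral>\<^sup>+j. ennreal \<bar>F (j + 1) x - F j x\<bar> \<partial>count_space UNIV) \<in> borel_measurable borel"
    by (rule borel_measurable_nn_integral_int) measurable
  ultimately show ?thesis by simp
qed

lemma W_measurable [measurable]: "W \<in> borel_measurable borel"
proof -
  have "(\<lambda>x. ennreal \<bar>F 1 x - x\<bar> / \<omega> x) \<in> borel_measurable borel" by measurable
  then show ?thesis by (simp add: W_def[abs_def])
qed

lemma k_measurable [measurable (raw)]:
  assumes [measurable]: "a \<in> borel_measurable M" "b \<in> borel_measurable M"
  shows "(\<lambda>z. k j (a z) (b z)) \<in> borel_measurable M"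
  unfolding k_def by measurable

lemma k_cocycle: "k i (F j x) (F j y) * (DF j x * DF j y) = k (i + j) x y"
  by (simp add: k_def F_add DF_add)

abbreviation J :: "real \<times> real \<Rightarrow> ennreal" where
  "J \<equiv> indicator ({0..1} \<times> {0..1})"

definition cnorm :: "nat \<Rightarrow> real \<times> real \<Rightarrow> ennreal" where
  "cnorm n p = ennreal \<bar>k (int n) (fst p) (snd p) - k 0 (fst p) (snd p)\<bar> * J p"

lemma J_measurable [measurable]: "J \<in> borel_measurable (borel \<Otimes>\<^sub>M borel)"
  by measurable

lemma cnorm_measurable [measurable]: "cnorm n \<in> borel_measurable (borel \<Otimes>\<^sub>M borel)"
  unfolding cnorm_def[abs_def] by measurable

definition shift_sum :: "nat \<Rightarrow> real \<times> real \<Rightarrow> ennreal" where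
  "shift_sum n p = (\<integral>\<^sup>+j. ennreal \<bar>k (j + int n) (fst p) (snd p) - k j (fst p) (snd p)\<bar> \<partial>count_space UNIV)"

lemma shift_sum_measurable [measurable]: "shift_sum n \<in> borel_measurable (borel \<Otimes>\<^sub>M borel)"
  unfolding shift_sum_def[abs_def] by (rule borel_measurable_nn_integral_int) measurable

text \<open>The cocycle identity for k absorbs the Jacobian, so pulling |c(f^n)| back by f^i x f^i
  just shifts both indices by i. The square is invariant, whence the unchanged factor
  \<open>J\<close>.\<close>

lemma cnorm_F:
  "cnorm n (F i x, F i y) * (ennreal (DF i x) * ennreal (DF i y))
    = ennreal \<bar>k (i + int n) x y - k i x y\<bar> * J (x, y)"
proof -
  have "\<bar>k (int n) (F i x) (F i y) - k 0 (F i x) (F i y)\<bar> * (DF i x * DF i y) = \<bar>k (i + int n) x y - k i x y\<bar>"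
  proof -
    have "\<bar>k (int n) (F i x) (F i y) - k 0 (F i x) (F i y)\<bar> * (DF i x * DF i y)
       = \<bar>(k (int n) (F i x) (F i y) - k 0 (F i x) (F i y)) * (DF i x * DF i y)\<bar>"
      by (simp add: abs_mult)
    then show ?thesis unfolding left_diff_distrib k_cocycle by (simp add: add.commute)
  qed
  then show ?thesis
    by (simp add: cnorm_def indicator_def mult.assoc flip: ennreal_mult')
qed

text \<open>After exchanging sum and integral, the j-th term is pulled back by f^(-j) x f^(-j). This
  moves the weight from f^j(x) to x and the index shift onto the kernel; replacing j by -j gives
  \<open>shift_sum\<close>.\<close>

lemma nn_integral_unfold_orbits:
  "(\<integral>\<^sup>+p. (\<integral>\<^sup>+j. W (F j (fst p)) \<partial>count_space UNIV) * cnorm n p \<partial>(lborel \<Otimes>\<^sub>M lborel))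
    = (\<integral>\<^sup>+p. W (fst p) * J p * shift_sum n p \<partial>(lborel \<Otimes>\<^sub>M lborel))"
proof -
  have "(\<integral>\<^sup>+p. (\<integral>\<^sup>+j. W (F j (fst p)) \<partial>count_space UNIV) * cnorm n p \<partial>(lborel \<Otimes>\<^sub>M lborel))
     = (\<integral>\<^sup>+p. (\<integral>\<^sup>+j. W (F j (fst p)) * cnorm n p \<partial>count_space UNIV) \<partial>(lborel \<Otimes>\<^sub>M lborel))"
    by (simp add: nn_integral_multc)
  also have "\<dots> = (\<integral>\<^sup>+j. (\<integral>\<^sup>+p. W (F j (fst p)) * cnorm n p \<partial>(lborel \<Otimes>\<^sub>M lborel)) \<partial>count_space UNIV)"
    by (rule nn_integral_count_space_nn_integral) (auto, measurable)
  also have "\<dots> = (\<integral>\<^sup>+j. (\<integral>\<^sup>+p. W (fst p) * (ennreal \<bar>k (- j + int n) (fst p) (snd p) - k (- j) (fst p) (snd p)\<bar> * J p)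
       \<partial>(lborel \<Otimes>\<^sub>M lborel)) \<partial>count_space UNIV)"
  proof (rule nn_integral_cong)
    fix j :: int
    have "(\<integral>\<^sup>+p. W (F j (fst p)) * cnorm n p \<partial>(lborel \<Otimes>\<^sub>M lborel))
      = (\<integral>\<^sup>+p. W (F j (fst (F (- j) (fst p), F (- j) (snd p)))) * cnorm n (F (- j) (fst p), F (- j) (snd p))
          * (ennreal (DF (- j) (fst p)) * ennreal (DF (- j) (snd p))) \<partial>(lborel \<Otimes>\<^sub>M lborel))"
      by (rule nn_integral_F_pair[symmetric]) measurable
    also have "\<dots> = (\<integral>\<^sup>+p. W (fst p) * (ennreal \<bar>k (- j + int n) (fst p) (snd p) - k (- j) (fst p) (snd p)\<bar> * J p)
       \<partial>(lborel \<Otimes>\<^sub>M lborel))"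
      by (simp only: fst_conv F_inverse mult.assoc cnorm_F prod.collapse)
    finally show "(\<integral>\<^sup>+p. W (F j (fst p)) * cnorm n p \<partial>(lborel \<Otimes>\<^sub>M lborel)) = \<dots>" .
  qed
  also have "\<dots> = (\<integral>\<^sup>+p. (\<integral>\<^sup>+j. W (fst p) * (ennreal \<bar>k (- j + int n) (fst p) (snd p) - k (- j) (fst p) (snd p)\<bar> * J p)
       \<partial>count_space UNIV) \<partial>(lborel \<Otimes>\<^sub>M lborel))"
    by (rule nn_integral_count_space_nn_integral[symmetric]) (auto, measurable)
  also have "\<dots> = (\<integral>\<^sup>+p. W (fst p) * J p * shift_sum n p \<partial>(lborel \<Otimes>\<^sub>M lborel))"
  proof (rule nn_integral_cong)
    fix p :: "real \<times> real"
    have "bij_betw uminus (UNIV :: int set) UNIV"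
      by (rule bij_betwI[where g = uminus]) auto
    then have "(\<integral>\<^sup>+j. ennreal \<bar>k (- j + int n) (fst p) (snd p) - k (- j) (fst p) (snd p)\<bar> \<partial>count_space UNIV) = shift_sum n p"
      unfolding shift_sum_def by (rule nn_integral_bij_count_space[where f = "\<lambda>j. ennreal \<bar>k (j + int n) (fst p) (snd p) - k j (fst p) (snd p)\<bar>"])
    then show "(\<integral>\<^sup>+j. W (fst p) * (ennreal \<bar>k (- j + int n) (fst p) (snd p) - k (- j) (fst p) (snd p)\<bar> * J p)
       \<partial>count_space UNIV) = W (fst p) * J p * shift_sum n p"
      by (simp add: nn_integral_cmult nn_integral_multc mult_ac)
  qed
  finally show ?thesis .
qed

end

section \<open>Convergence of the averaged norms\<close>

context vanishing_variation_action begin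

text \<open>Each weight sum is 1 if its coordinate is moved and 0 if it is fixed. If both
  coordinates are fixed, the left side vanishes by \<open>fixed_parabolic\<close>.\<close>

lemma cnorm_le:
  "cnorm n (x, y) \<le> (\<integral>\<^sup>+j. W (F j x) \<partial>count_space UNIV) * cnorm n (x, y)
    + (\<integral>\<^sup>+j. W (F j y) \<partial>count_space UNIV) * cnorm n (x, y)"
proof (cases "x \<in> {0..1} \<and> y \<in> {0..1}")
  case True
  have "cnorm n (x, y) = 0" if "F 1 x = x" "F 1 y = y"
    using that True by (simp add: cnorm_def k_def fixed_parabolic F_fixed)
  then show ?thesis using True by (auto simp: sum_W)
next
  case False
  then have "cnorm n (x, y) = 0" by (auto simp: cnorm_def indicator_def)
  then show ?thesis by simp
qed

text \<open>The kernel is symmetric, so the part weighted in y equals the part weighted in x; hence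
  the factor 2.\<close>

lemma nn_integral_cnorm_le:
  "(\<integral>\<^sup>+p. cnorm n p \<partial>(lborel \<Otimes>\<^sub>M lborel)) \<le> 2 * (\<integral>\<^sup>+p. W (fst p) * J p * shift_sum n p \<partial>(lborel \<Otimes>\<^sub>M lborel))"
proof -
  define \<nu> where "\<nu> x = (\<integral>\<^sup>+j. W (F j x) \<partial>count_space UNIV)" for x
  have [measurable]: "\<nu> \<in> borel_measurable borel"
    unfolding \<nu>_def[abs_def] by (rule borel_measurable_nn_integral_int) measurable
  have sym: "cnorm n (x, y) = cnorm n (y, x)" for x y
    by (simp add: cnorm_def k_commute[of _ x y] indicator_def conj_commute)
  have "(\<integral>\<^sup>+p. cnorm n p \<partial>(lborel \<Otimes>\<^sub>M lborel))
     \<le> (\<integral>\<^sup>+p. \<nu> (fst p) * cnorm n p + \<nu> (snd p) * cnorm n p \<partial>(lborel \<Otimes>\<^sub>M lborel))"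
    using cnorm_le by (intro nn_integral_mono) (auto simp: \<nu>_def)
  also have "\<dots> = (\<integral>\<^sup>+p. \<nu> (fst p) * cnorm n p \<partial>(lborel \<Otimes>\<^sub>M lborel)) + (\<integral>\<^sup>+p. \<nu> (snd p) * cnorm n p \<partial>(lborel \<Otimes>\<^sub>M lborel))"
    by (rule nn_integral_add) measurable
  also have "(\<integral>\<^sup>+p. \<nu> (snd p) * cnorm n p \<partial>(lborel \<Otimes>\<^sub>M lborel)) = (\<integral>\<^sup>+y. \<integral>\<^sup>+x. \<nu> y * cnorm n (x, y) \<partial>lborel \<partial>lborel)"
    by (subst lborel_pair.nn_integral_snd[symmetric]) simp_all
  also have "\<dots> = (\<integral>\<^sup>+y. \<integral>\<^sup>+x. \<nu> y * cnorm n (y, x) \<partial>lborel \<partial>lborel)"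
    by (simp only: sym)
  also have "\<dots> = (\<integral>\<^sup>+p. \<nu> (fst p) * cnorm n p \<partial>(lborel \<Otimes>\<^sub>M lborel))"
    by (subst lborel.nn_integral_fst[symmetric]) simp_all
  finally show ?thesis
    unfolding nn_integral_unfold_orbits[of n, folded \<nu>_def] by (simp add: mult_2)
qed

text \<open>The pairs that \<open>k_diff_tendsto_0\<close> excludes lie on the diagonal or on the
  graph of the forward or backward limit of the orbit of x. Each is the graph of a measurable
  function, hence null.\<close>

lemma AE_k_diff_tendsto_0:
  "AE p in lborel \<Otimes>\<^sub>M lborel. p \<in> {0..1} \<times> {0..1} \<longrightarrow> F 1 (fst p) \<noteq> fst p \<longrightarrow>
    (\<lambda>n. k (int n) (fst p) (snd p) - k (- int n) (fst p) (snd p)) \<longlonglongrightarrow> 0"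
proof -
  have 1: "AE p in lborel \<Otimes>\<^sub>M lborel. snd p \<noteq> (fst p :: real)"
    using AE_not_on_graph[of "\<lambda>x. x"] by simp
  have [measurable]: "(\<lambda>x. lim (\<lambda>n. F (int n) x)) \<in> borel_measurable borel"
    by (rule borel_measurable_lim_metric) measurable
  have 2: "AE p in lborel \<Otimes>\<^sub>M lborel. snd p \<noteq> lim (\<lambda>n. F (int n) (fst p))"
    by (rule AE_not_on_graph[of "\<lambda>x. lim (\<lambda>n. F (int n) x)"]) measurable
  have [measurable]: "(\<lambda>x. lim (\<lambda>n. F (- int n) x)) \<in> borel_measurable borel"
    by (rule borel_measurable_lim_metric) measurable
  have 3: "AE p in lborel \<Otimes>\<^sub>M lborel. snd p \<noteq> lim (\<lambda>n. F (- int n) (fst p))"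
    by (rule AE_not_on_graph[of "\<lambda>x. lim (\<lambda>n. F (- int n) x)"]) measurable
  from 1 2 3 show ?thesis
  proof eventually_elim
    case (elim p)
    have "\<not> (\<lambda>n. F (int n) (fst p)) \<longlonglongrightarrow> snd p" "\<not> (\<lambda>n. F (- int n) (fst p)) \<longlonglongrightarrow> snd p"
      using elim(2,3) limI by metis+
    then show ?case
      using k_diff_tendsto_0[of "fst p" "snd p"] elim(1) unfolding mem_Times_iff by blast
  qed
qed

theorem nn_integral_cnorm_tendsto_0:
  "(\<lambda>n. (\<integral>\<^sup>+p. cnorm n p \<partial>(lborel \<Otimes>\<^sub>M lborel)) / of_nat n) \<longlonglongrightarrow> 0"
proof -
  define M where "M = (lborel \<Otimes>\<^sub>M lborel :: (real \<times> real) measure)"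
  have [measurable_cong]: "sets M = sets (borel \<Otimes>\<^sub>M borel)"
    unfolding M_def by (simp cong: sets_pair_measure_cong)
  define w where "w p = W (fst p) * J p * shift_sum 1 p" for p
  have [measurable]: "w \<in> borel_measurable M" unfolding w_def[abs_def] by measurable
  have fin: "(\<integral>\<^sup>+p. w p \<partial>M) < \<infinity>"
  proof -
    have "(\<integral>\<^sup>+p. w p \<partial>M) = (\<integral>\<^sup>+p. (\<integral>\<^sup>+j. W (F j (fst p)) \<partial>count_space UNIV) * cnorm 1 p \<partial>M)"
      by (simp add: w_def M_def nn_integral_unfold_orbits)
    also have "\<dots> \<le> (\<integral>\<^sup>+p. ennreal C * indicator ({0..1} \<times> {0..1}) p \<partial>M)"
    proof (rule nn_integral_mono)
      fix p :: "real \<times> real"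
      have "(\<integral>\<^sup>+j. W (F j x) \<partial>count_space UNIV) * cnorm 1 (x, y) \<le> ennreal C"
        if "x \<in> {0..1}" "y \<in> {0..1}" for x y
      proof -
        have "C \<ge> 0" using kernel_bound[of 0 1] by auto
        \<comment> \<open>On the diagonal both kernels are 0, by division by zero.\<close>
        then have "\<bar>k 1 x y - k 0 x y\<bar> \<le> C"
          using kernel_bound[OF that] by (cases "x = y") (auto simp: k_def)
        then have "cnorm 1 (x, y) \<le> ennreal C" using that by (simp add: cnorm_def ennreal_leI)
        then show ?thesis using sum_W[OF that(1)] by simp
      qed
      then show "(\<integral>\<^sup>+j. W (F j (fst p)) \<partial>count_space UNIV) * cnorm 1 p \<le> ennreal C * indicator ({0..1} \<times> {0..1}) p"
        by (cases p) (auto simp: cnorm_def indicator_def)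
    qed
    also have "\<dots> = ennreal C * emeasure M ({0..1} \<times> {0..1})"
      by (rule nn_integral_cmult_indicator) measurable
    also have "emeasure M ({0..1} \<times> {0..1}) = 1"
      unfolding M_def by (subst lborel.emeasure_pair_measure_Times) auto
    finally have "(\<integral>\<^sup>+p. w p \<partial>M) \<le> ennreal C" by simp
    then show ?thesis by (rule le_less_trans) simp
  qed
  define u where "u n p = W (fst p) * J p * (shift_sum n p / of_nat n)" for n p
  have [measurable]: "u n \<in> borel_measurable M" for n unfolding u_def[abs_def] by measurable
  have "(\<lambda>n. \<integral>\<^sup>+p. u n p \<partial>M) \<longlonglongrightarrow> (\<integral>\<^sup>+p. 0 \<partial>M)"
  proof (rule nn_integral_dominated_convergence[where w = w])
    show "AE p in M. u n p \<le> w p" for n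
    proof (rule AE_I2)
      fix p
      have le: "shift_sum n p \<le> of_nat n * shift_sum 1 p"
        unfolding shift_sum_def using shift_sum_le[where b = "\<lambda>j. k j (fst p) (snd p)"] by simp
      have "shift_sum n p / of_nat n \<le> shift_sum 1 p"
      \<comment> \<open>For n = 0 the bound \<open>le\<close> forces the numerator to be 0, and
        \<open>0 / 0\<close> is 0 rather than infinite.\<close>
      proof (cases "n = 0")
        case True
        then show ?thesis using le by simp
      next
        case False
        have "shift_sum n p / of_nat n \<le> (of_nat n * shift_sum 1 p) / of_nat n"
          by (rule divide_right_mono_ennreal[OF le])
        also have "\<dots> = shift_sum 1 p"
          unfolding mult.commute[of "of_nat n"] by (rule mult_divide_eq_ennreal) (use False in auto)
        finally show ?thesis .
      qed
      then show "u n p \<le> w p" unfolding u_def w_def by (intro mult_left_mono) auto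
    qed
    \<comment> \<open>Where the weight is non-zero, this makes \<open>shift_sum 1 p\<close> finite:
      the bounded variation in j that \<open>shift_sum_tendsto_0\<close> requires.\<close>
    have "AE p in M. w p \<noteq> \<infinity>" using fin by (intro nn_integral_PInf_AE) auto
    moreover have "AE p in M. p \<in> {0..1} \<times> {0..1} \<longrightarrow> F 1 (fst p) \<noteq> fst p \<longrightarrow>
      (\<lambda>n. k (int n) (fst p) (snd p) - k (- int n) (fst p) (snd p)) \<longlonglongrightarrow> 0"
      unfolding M_def by (rule AE_k_diff_tendsto_0)
    ultimately show "AE p in M. (\<lambda>n. u n p) \<longlonglongrightarrow> 0"
    proof eventually_elim
      case (elim p)
      show ?case
      proof (cases "p \<in> {0..1} \<times> {0..1} \<and> F 1 (fst p) \<noteq> fst p")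
        case True
        then have x: "fst p \<in> {0..1}" by auto
        have W: "W (fst p) \<noteq> 0" "W (fst p) < top"
          using True omega_finite[OF x] omega_pos[of "fst p"]
          by (auto simp: W_def ennreal_divide_eq_0_iff ennreal_divide_eq_top_iff less_top[symmetric])
        then have "shift_sum 1 p < \<infinity>"
          using elim(1) True by (auto simp: w_def ennreal_mult_eq_top_iff less_top)
        then have "(\<lambda>n. shift_sum n p / of_nat n) \<longlonglongrightarrow> 0"
          using True elim(2) unfolding shift_sum_def by (intro shift_sum_tendsto_0) auto
        then have "(\<lambda>n. W (fst p) * (shift_sum n p / of_nat n)) \<longlonglongrightarrow> W (fst p) * 0"
          by (rule ennreal_tendsto_cmult[OF W(2)])
        then show ?thesis using True by (simp add: u_def)
      next
        case False
        then have "u n p = 0" for n by (auto simp: u_def W_def indicator_def)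
        then show ?thesis by simp
      qed
    qed
  qed (use fin in auto)
  then have "(\<lambda>n. 2 * (\<integral>\<^sup>+p. u n p \<partial>M)) \<longlonglongrightarrow> 2 * 0"
    by (intro ennreal_tendsto_cmult) auto
  then have lim: "(\<lambda>n. 2 * (\<integral>\<^sup>+p. u n p \<partial>M)) \<longlonglongrightarrow> 0" by simp
  have "(\<integral>\<^sup>+p. cnorm n p \<partial>M) / of_nat n \<le> 2 * (\<integral>\<^sup>+p. u n p \<partial>M)" for n
  proof -
    have "(\<integral>\<^sup>+p. u n p \<partial>M) = (\<integral>\<^sup>+p. W (fst p) * J p * shift_sum n p \<partial>M) / of_nat n"
      unfolding u_def ennreal_times_divide by (rule nn_integral_divide) measurable
    then show ?thesis
      using divide_right_mono_ennreal[OF nn_integral_cnorm_le[of n], of "of_nat n"]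
      by (simp add: M_def ennreal_times_divide)
  qed
  then show ?thesis unfolding M_def[symmetric]
    by (intro tendsto_sandwich[OF _ _ tendsto_const lim]) auto
qed

end

section \<open>Smooth diffeomorphisms\<close>

lemma D01_eqI:
  assumes "(h has_real_derivative d) (at x within {0..1})" "x \<in> {0..1}"
  shows "D01 h x = d"
  using vector_derivative_within_cbox[of 0 1 x h d] assms
  by (simp add: D01_def has_real_derivative_iff_has_vector_derivative)

lemma D01_cong:
  assumes "\<And>x. x \<in> {0..1} \<Longrightarrow> h x = h' x" "x \<in> {0..1}"
  shows "D01 h x = D01 h' x"
  unfolding D01_def by (rule vector_derivative_cong_eq) (use assms in auto)

lemma D01_works:
  assumes "h differentiable_on {0..1}" "x \<in> {0..1}"
  shows "(h has_real_derivative D01 h x) (at x within {0..1})"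
proof -
  have "h differentiable (at x within {0..1})" using assms by (simp add: differentiable_on_def)
  then show ?thesis
    by (simp add: vector_derivative_works[THEN iffD1] D01_def has_real_derivative_iff_has_vector_derivative)
qed

section \<open>Boundedness of the kernel c(f)\<close>

text \<open>Two uses of the mean value inequality. The derivative of \<psi> is half of p t - p a -
  (t - a) * q t, and this error is bounded by applying the inequality to p s - s * q t as a function
  of s, whose derivative q s - q t is small by the Lipschitz condition.\<close>

lemma trapezoid_error:
  fixes f p q :: "real \<Rightarrow> real"
  assumes ab: "a < b"
    and f: "\<And>t. t \<in> {a..b} \<Longrightarrow> (f has_real_derivative p t) (at t within {a..b})"
    and p: "\<And>t. t \<in> {a..b} \<Longrightarrow> (p has_real_derivative q t) (at t within {a..b})"
    and q: "\<And>s t. s \<in> {a..b} \<Longrightarrow> t \<in> {a..b} \<Longrightarrow> \<bar>q s - q t\<bar> \<le> M * \<bar>s - t\<bar>"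
  shows "\<bar>f b - f a - (b - a) * ((p a + p b) / 2)\<bar> \<le> M * (b - a) ^ 3 / 2"
proof -
  have "0 \<le> M * \<bar>a - b\<bar>" using q[of a b] ab by (intro order_trans[OF abs_ge_zero]) auto
  then have M: "M \<ge> 0" using ab by (simp add: zero_le_mult_iff)
  have p_err: "\<bar>p t - p a - (t - a) * q t\<bar> \<le> M * (b - a)\<^sup>2" if t: "t \<in> {a..b}" for t
  proof -
    have "norm ((p t - t * q t) - (p a - a * q t)) \<le> (M * (b - a)) * norm (t - a)"
    proof (rule field_differentiable_bound[where S = "{a..b}" and f' = "\<lambda>s. q s - q t"])
      show "((\<lambda>s. p s - s * q t) has_real_derivative q s - q t) (at s within {a..b})" if "s \<in> {a..b}" for s
        using p[OF that] by (auto intro!: derivative_eq_intros)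
      show "norm (q s - q t) \<le> M * (b - a)" if "s \<in> {a..b}" for s
      proof -
        have "M * \<bar>s - t\<bar> \<le> M * (b - a)" using that t M by (intro mult_left_mono) auto
        then show ?thesis using q[OF that t] by simp
      qed
    qed (use t ab in auto)
    also have "\<dots> \<le> (M * (b - a)) * (b - a)"
      using t M ab by (intro mult_left_mono) auto
    finally show ?thesis by (simp add: algebra_simps power2_eq_square)
  qed
  define \<psi> where "\<psi> t = f t - (t - a) * ((p a + p t) / 2)" for t
  have "norm (\<psi> b - \<psi> a) \<le> (M * (b - a)\<^sup>2 / 2) * norm (b - a)"
  proof (rule field_differentiable_bound[where S = "{a..b}" and f' = "\<lambda>t. (p t - p a - (t - a) * q t) / 2"])
    show "(\<psi> has_real_derivative (p t - p a - (t - a) * q t) / 2) (at t within {a..b})" if "t \<in> {a..b}" for t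
      unfolding \<psi>_def[abs_def] using p[OF that] f[OF that]
      by (auto intro!: derivative_eq_intros simp: field_simps)
    show "norm ((p t - p a - (t - a) * q t) / 2) \<le> M * (b - a)\<^sup>2 / 2" if "t \<in> {a..b}" for t
      using p_err[OF that] by simp
  qed (use ab in auto)
  moreover have "\<psi> b - \<psi> a = f b - f a - (b - a) * ((p a + p b) / 2)"
    by (simp add: \<psi>_def)
  ultimately show ?thesis using ab by (simp add: power2_eq_square power3_eq_cube mult_ac)
qed

text \<open>With \<open>A\<close> the mean of \<open>p\<close> over \<open>[a,b]\<close>, the kernel is \<open>(p a * p b - A\<^sup>2) / ((b - a)\<^sup>2 * A\<^sup>2)\<close>.
  Since \<open>p a * p b\<close> is \<open>((p a + p b) / 2)\<^sup>2\<close> up to \<open>O((b - a)\<^sup>2)\<close>, and so is \<open>A\<^sup>2\<close> by the trapezoidal rule,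
  the singularity cancels.\<close>

lemma cross_ratio_kernel_bound:
  fixes f p q :: "real \<Rightarrow> real"
  assumes f: "\<And>t. t \<in> {0..1} \<Longrightarrow> (f has_real_derivative p t) (at t within {0..1})"
    and p: "\<And>t. t \<in> {0..1} \<Longrightarrow> (p has_real_derivative q t) (at t within {0..1})"
    and q: "\<And>s t. s \<in> {0..1} \<Longrightarrow> t \<in> {0..1} \<Longrightarrow> \<bar>q s - q t\<bar> \<le> M2 * \<bar>s - t\<bar>"
    and m: "m > 0" "\<And>t. t \<in> {0..1} \<Longrightarrow> m \<le> p t"
    and M0: "\<And>t. t \<in> {0..1} \<Longrightarrow> \<bar>p t\<bar> \<le> M0"
    and M1: "\<And>t. t \<in> {0..1} \<Longrightarrow> \<bar>q t\<bar> \<le> M1"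
    and xy: "x \<in> {0..1}" "y \<in> {0..1}" "x \<noteq> y"
  shows "\<bar>p x * p y / (f x - f y)\<^sup>2 - 1 / (x - y)\<^sup>2\<bar> \<le> (M1\<^sup>2 / 4 + M0 * M2) / m\<^sup>2"
proof -
  have main: "\<bar>p b * p a / (f b - f a)\<^sup>2 - 1 / (b - a)\<^sup>2\<bar> \<le> (M1\<^sup>2 / 4 + M0 * M2) / m\<^sup>2"
    if I: "a \<in> {0..1}" "b \<in> {0..1}" and ab: "a < b" for a b
  proof -
    define h where "h = b - a"
    have h: "h > 0" using ab by (simp add: h_def)
    define A where "A = (f b - f a) / h"
    define s where "s = (p a + p b) / 2"
    have sub: "{a..b} \<subseteq> {0..1}" using I by auto
    have f': "(f has_real_derivative p t) (at t within {a..b})" if "t \<in> {a..b}" for t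
      using that sub by (intro has_field_derivative_subset[OF f]) auto
    have p': "(p has_real_derivative q t) (at t within {a..b})" if "t \<in> {a..b}" for t
      using that sub by (intro has_field_derivative_subset[OF p]) auto
    have "\<exists>t\<in>{a<..<b}. f b - f a = (*) (p t) (b - a)"
      by (rule mvt_simple[OF ab]) (use f' in \<open>simp add: has_field_derivative_def\<close>)
    then obtain t where t: "t \<in> {a<..<b}" "f b - f a = p t * h" by (auto simp: h_def)
    then have "A = p t" using h by (simp add: A_def)
    then have A: "m \<le> A" "A \<le> M0" using t sub m(2)[of t] M0[of t] by auto
    have s: "0 \<le> s" "s \<le> M0"
      using M0[OF I(1)] M0[OF I(2)] m(1) m(2)[OF I(1)] m(2)[OF I(2)] by (auto simp: s_def)
    have "\<bar>f b - f a - h * s\<bar> \<le> M2 * h ^ 3 / 2"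
      unfolding s_def h_def using sub by (intro trapezoid_error[OF ab f' p' q]) auto
    moreover have "f b - f a - h * s = h * (A - s)" using h by (simp add: A_def field_simps)
    ultimately have "h * \<bar>A - s\<bar> \<le> h * (M2 * h\<^sup>2 / 2)"
      using h by (simp add: abs_mult power2_eq_square power3_eq_cube mult_ac)
    then have As: "\<bar>A - s\<bar> \<le> M2 * h\<^sup>2 / 2" using h by simp
    have "\<bar>p b - p a\<bar> \<le> M1 * h"
      using field_differentiable_bound[of "{0..1}" p q M1 b a] p M1 I h by (simp add: h_def)
    then have "\<bar>p b - p a\<bar>\<^sup>2 \<le> (M1 * h)\<^sup>2" by (intro power_mono) auto
    then have pp: "(p b - p a)\<^sup>2 \<le> M1\<^sup>2 * h\<^sup>2" by (simp add: power_mult_distrib)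
    have "\<bar>s\<^sup>2 - A\<^sup>2\<bar> = \<bar>A - s\<bar> * (s + A)"
      using s A m(1) by (simp add: power2_eq_square square_diff_square_factored abs_mult abs_minus_commute)
    also have "\<dots> \<le> (M2 * h\<^sup>2 / 2) * (M0 + M0)"
      using As order_trans[OF abs_ge_zero As] s A m(1) by (intro mult_mono) auto
    finally have sA: "\<bar>s\<^sup>2 - A\<^sup>2\<bar> \<le> M0 * M2 * h\<^sup>2" by (simp add: algebra_simps)
    \<comment> \<open>The constant comes from these two terms: M0 * M2 from |A - s| \<le> M2 * h^2 /
      2 times s + A \<le> 2 * M0, and M1^2 / 4 from the square of p b - p a.\<close>
    have "p b * p a - A\<^sup>2 = (s\<^sup>2 - A\<^sup>2) - (p b - p a)\<^sup>2 / 4"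
      by (simp add: s_def power2_eq_square field_simps)
    then have "\<bar>p b * p a - A\<^sup>2\<bar> \<le> \<bar>s\<^sup>2 - A\<^sup>2\<bar> + (p b - p a)\<^sup>2 / 4"
      using abs_triangle_ineq4[of "s\<^sup>2 - A\<^sup>2" "(p b - p a)\<^sup>2 / 4"] by simp
    then have num: "\<bar>p b * p a - A\<^sup>2\<bar> \<le> (M1\<^sup>2 / 4 + M0 * M2) * h\<^sup>2"
      using sA pp by (simp add: algebra_simps)
    have A0: "A > 0" using A m by simp
    have "f b - f a = h * A" using h by (simp add: A_def)
    then have "p b * p a / (f b - f a)\<^sup>2 - 1 / (b - a)\<^sup>2 = (p b * p a - A\<^sup>2) / (h\<^sup>2 * A\<^sup>2)"
      using h A0 by (simp add: h_def[symmetric] power_mult_distrib field_simps)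
    then have "\<bar>p b * p a / (f b - f a)\<^sup>2 - 1 / (b - a)\<^sup>2\<bar> = \<bar>p b * p a - A\<^sup>2\<bar> / (h\<^sup>2 * A\<^sup>2)"
      by (simp add: abs_divide)
    also have "\<dots> \<le> (M1\<^sup>2 / 4 + M0 * M2) * h\<^sup>2 / (h\<^sup>2 * m\<^sup>2)"
    proof (rule frac_le[OF _ num])
      show "0 \<le> (M1\<^sup>2 / 4 + M0 * M2) * h\<^sup>2" using num by (rule order_trans[OF abs_ge_zero])
      show "0 < h\<^sup>2 * m\<^sup>2" using h m by simp
      show "h\<^sup>2 * m\<^sup>2 \<le> h\<^sup>2 * A\<^sup>2" using A m by (intro mult_left_mono power_mono) auto
    qed
    also have "\<dots> = (M1\<^sup>2 / 4 + M0 * M2) / m\<^sup>2" using h by simp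
    finally show ?thesis .
  qed
  show ?thesis
  proof (cases "x < y")
    case True
    then show ?thesis using main[of x y] xy by (simp add: power2_commute mult.commute)
  next
    case False
    then show ?thesis using main[of y x] xy by simp
  qed
qed

text \<open>The regularity asked of a general iterate. An explicit derivative h' makes closure under
  composition a matter of the chain rule.\<close>

definition C1_self_map :: "(real \<Rightarrow> real) \<Rightarrow> bool" where
  "C1_self_map h \<longleftrightarrow> h ` {0..1} \<subseteq> {0..1} \<and>
    (\<exists>h'. continuous_on {0..1} h' \<and> (\<forall>x\<in>{0..1}. (h has_real_derivative h' x) (at x within {0..1})))"

lemma has_real_derivative_comp01:
  assumes "(h has_real_derivative d) (at (g x) within {0..1})" "(g has_real_derivative e) (at x within {0..1})"
    "g ` {0..1} \<subseteq> {0..1}"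
  shows "((\<lambda>x. h (g x)) has_real_derivative d * e) (at x within {0..1})"
  using DERIV_image_chain[OF has_field_derivative_subset[OF assms(1,3)] assms(2)] by (simp add: o_def)

lemma C1_self_map_comp:
  assumes "C1_self_map h" "C1_self_map g"
  shows "C1_self_map (\<lambda>x. h (g x))"
proof -
  obtain h' where h: "h ` {0..1} \<subseteq> {0..1}" "continuous_on {0..1} h'"
    "\<And>x. x \<in> {0..1} \<Longrightarrow> (h has_real_derivative h' x) (at x within {0..1})"
    using assms(1) by (auto simp: C1_self_map_def)
  obtain g' where g: "g ` {0..1} \<subseteq> {0..1}" "continuous_on {0..1} g'"
    "\<And>x. x \<in> {0..1} \<Longrightarrow> (g has_real_derivative g' x) (at x within {0..1})"
    using assms(2) by (auto simp: C1_self_map_def)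
  have "continuous_on {0..1} g" using g(3) by (rule DERIV_continuous_on)
  then have "continuous_on {0..1} (\<lambda>x. h' (g x) * g' x)"
    by (intro continuous_on_mult continuous_on_compose2[OF h(2)] g)
  moreover have "((\<lambda>x. h (g x)) has_real_derivative h' (g x) * g' x) (at x within {0..1})" if "x \<in> {0..1}" for x
    by (rule has_real_derivative_comp01[where h = h and g = g]) (use g(1) that in \<open>auto intro!: h g\<close>)
  ultimately show ?thesis
    using h(1) g(1) unfolding C1_self_map_def by (intro conjI exI[of _ "\<lambda>x. h' (g x) * g' x"]) blast+
qed

lemma C1_self_map_cong:
  assumes "C1_self_map h" "\<And>x. x \<in> {0..1} \<Longrightarrow> h x = g x"
  shows "C1_self_map g"
proof -
  obtain h' where h: "h ` {0..1} \<subseteq> {0..1}" "continuous_on {0..1} h'"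
    "\<And>x. x \<in> {0..1} \<Longrightarrow> (h has_real_derivative h' x) (at x within {0..1})"
    using assms(1) by (auto simp: C1_self_map_def)
  have "(g has_real_derivative h' x) (at x within {0..1})" if "x \<in> {0..1}" for x
    by (rule has_field_derivative_transform_within[OF h(3)[OF that] zero_less_one that]) (use assms(2) in auto)
  moreover have "g ` {0..1} = h ` {0..1}" using assms(2) by (intro image_cong) auto
  ultimately show ?thesis unfolding C1_self_map_def using h by auto
qed

lemma C1_self_map_id: "C1_self_map (\<lambda>x. x)"
  unfolding C1_self_map_def
  by (intro conjI exI[of _ "\<lambda>_. 1"]) (auto intro!: derivative_eq_intros)

lemma C1_self_map_funpow: "C1_self_map h \<Longrightarrow> C1_self_map (h ^^ n)"
  by (induction n) (auto simp: o_def id_def intro: C1_self_map_id C1_self_map_comp[of h])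

lemma C1_self_map_D01:
  assumes "C1_self_map h"
  shows "continuous_on {0..1} (D01 h)"
    and "x \<in> {0..1} \<Longrightarrow> (h has_real_derivative D01 h x) (at x within {0..1})"
proof -
  obtain h' where h: "continuous_on {0..1} h'"
    "\<And>x. x \<in> {0..1} \<Longrightarrow> (h has_real_derivative h' x) (at x within {0..1})"
    using assms by (auto simp: C1_self_map_def)
  have eq: "D01 h x = h' x" if "x \<in> {0..1}" for x using D01_eqI[OF h(2)[OF that] that] .
  then show "x \<in> {0..1} \<Longrightarrow> (h has_real_derivative D01 h x) (at x within {0..1})" using h(2) by simp
  show "continuous_on {0..1} (D01 h)" using h(1) eq by (metis (no_types, lifting) continuous_on_cong)
qed

lemma smooth01_derivative:
  assumes "smooth01 f" "x \<in> {0..1}"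
  shows "((D01 ^^ n) f has_real_derivative (D01 ^^ Suc n) f x) (at x within {0..1})"
  using D01_works[of "(D01 ^^ n) f" x] assms by (simp add: smooth01_def)

lemma smooth01_continuous: "smooth01 f \<Longrightarrow> continuous_on {0..1} ((D01 ^^ n) f)"
  by (simp add: smooth01_def differentiable_imp_continuous_on)

lemma smooth01_bounded:
  assumes "smooth01 f"
  obtains B where "\<And>x. x \<in> {0..1} \<Longrightarrow> \<bar>(D01 ^^ n) f x\<bar> \<le> B"
proof -
  have "compact ((D01 ^^ n) f ` {0..1})"
    using smooth01_continuous[OF assms] by (rule compact_continuous_image) simp
  then have "bounded ((D01 ^^ n) f ` {0..1})" by (rule compact_imp_bounded)
  then obtain B where "\<forall>y\<in>(D01 ^^ n) f ` {0..1}. \<bar>y\<bar> \<le> B" by (auto simp: bounded_real)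
  then show ?thesis using that by blast
qed

lemma smooth01_C1_self_map:
  assumes "smooth01 f" "f ` {0..1} \<subseteq> {0..1}"
  shows "C1_self_map f"
  unfolding C1_self_map_def
  using assms smooth01_derivative[of f _ 0] smooth01_continuous[of f 1] by auto

section \<open>The action generated by a smooth diffeomorphism\<close>

locale interval_diffeo =
  fixes f :: "real \<Rightarrow> real"
  assumes diffeo: "smooth_diffeo01 f"
begin

abbreviation finv :: "real \<Rightarrow> real" where "finv \<equiv> inv_into {0..1} f"

text \<open>The values of f and of \<open>finv\<close> outside [0,1] are arbitrary. Replacing them
  by the identity makes \<open>fx\<close> and \<open>gx\<close> mutually inverse on the whole line,
  so that integer powers add.\<close>

definition fx :: "real \<Rightarrow> real" where "fx x = (if x \<in> {0..1} then f x else x)"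
definition gx :: "real \<Rightarrow> real" where "gx x = (if x \<in> {0..1} then finv x else x)"

definition F :: "int \<Rightarrow> real \<Rightarrow> real" where
  "F j = (if j \<ge> 0 then fx ^^ nat j else gx ^^ nat (- j))"

definition DF :: "int \<Rightarrow> real \<Rightarrow> real" where
  "DF j x = (if x \<in> {0..1} then D01 (F j) x else 1)"

lemma bij: "bij_betw f {0..1} {0..1}" and smooth: "smooth01 f" "smooth01 finv"
  and mono: "strict_mono_on {0..1} f"
  using diffeo by (auto simp: smooth_diffeo01_def)

lemma f_in: "x \<in> {0..1} \<Longrightarrow> f x \<in> {0..1}"
  using bij bij_betwE by blast

lemma finv_in: "x \<in> {0..1} \<Longrightarrow> finv x \<in> {0..1}"
  using bij_betw_inv_into[OF bij] bij_betwE by blast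

lemma gx_fx [simp]: "gx (fx x) = x" and fx_gx [simp]: "fx (gx x) = x"
proof -
  show "gx (fx x) = x"
    using f_in[of x] bij_betw_inv_into_left[OF bij, of x] by (auto simp: fx_def gx_def)
  show "fx (gx x) = x"
    using finv_in[of x] bij_betw_inv_into_right[OF bij, of x] by (auto simp: fx_def gx_def)
qed

lemma fx_less: assumes "x < y" shows "fx x < fx y"
  using f_in[of x] f_in[of y] strict_mono_onD[OF mono, of x y] assms by (auto simp: fx_def)

lemma gx_less: "x < y \<Longrightarrow> gx x < gx y"
  using fx_less[of "gx y" "gx x"] by (cases "gx x" "gx y" rule: linorder_cases) (auto dest: arg_cong[of _ _ fx])

lemma C1_fx: "C1_self_map fx"
  by (rule C1_self_map_cong[OF smooth01_C1_self_map[OF smooth(1)]]) (use f_in in \<open>auto simp: fx_def\<close>)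

lemma C1_gx: "C1_self_map gx"
  by (rule C1_self_map_cong[OF smooth01_C1_self_map[OF smooth(2)]]) (use finv_in in \<open>auto simp: gx_def\<close>)

lemma C1_F: "C1_self_map (F j)"
  by (simp add: F_def C1_fx C1_gx C1_self_map_funpow)

lemma F_0: "F 0 x = x" by (simp add: F_def)

lemma F_Suc: "F (j + 1) x = fx (F j x)"
proof (cases "j \<ge> 0")
  case True
  then show ?thesis by (simp add: F_def nat_add_distrib)
next
  case False
  then obtain m where m: "nat (- j) = Suc m" by (metis not_le zero_less_nat_eq neg_0_less_iff_less gr0_implies_Suc)
  \<comment> \<open>For j = -1 the index j + 1 = 0 already belongs to the other branch of
    \<open>F\<close>; both branches give the identity there.\<close>
  then have "nat (- (j + 1)) = m" "j + 1 \<ge> 0 \<longrightarrow> m = 0" by auto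
  then show ?thesis using False m by (cases "j + 1 \<ge> 0") (auto simp: F_def)
qed

lemma F_pred: "F (j - 1) x = gx (F j x)"
  using F_Suc[of "j - 1" x] by simp

lemma F_add: "F (i + j) x = F i (F j x)"
proof (induction i rule: int_induct[where k = 0])
  case (step1 i)
  then show ?case using F_Suc[of "i + j" x] F_Suc[of i "F j x"] by (simp add: algebra_simps)
next
  case (step2 i)
  then show ?case using F_pred[of "i + j" x] F_pred[of i "F j x"] by (simp add: algebra_simps)
qed (simp add: F_0)

lemma F_less: "x < y \<Longrightarrow> F j x < F j y"
proof (induction j rule: int_induct[where k = 0])
  case (step1 i)
  then show ?case by (simp add: F_Suc fx_less)
next
  case (step2 i)
  then show ?case by (simp add: F_pred gx_less)
qed (simp add: F_0)

lemma F_outside: assumes x: "x \<notin> {0..1}" shows "F j x = x"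
proof (induction j rule: int_induct[where k = 0])
  case (step1 i)
  then show ?case using x by (auto simp: F_Suc fx_def)
next
  case (step2 i)
  then show ?case using x by (auto simp: F_pred gx_def)
qed (simp add: F_0)

lemma F_in: "x \<in> {0..1} \<Longrightarrow> F j x \<in> {0..1}"
  using C1_F[of j] unfolding C1_self_map_def by blast

lemma DF_works: "x \<in> {0..1} \<Longrightarrow> (F j has_real_derivative DF j x) (at x within {0..1})"
  using C1_self_map_D01(2)[OF C1_F] by (simp add: DF_def)

lemma DF_cont: "continuous_on {0..1} (DF j)"
  using C1_self_map_D01(1)[OF C1_F] by (rule continuous_on_eq) (simp add: DF_def)

lemma DF_add: "DF (i + j) x = DF i (F j x) * DF j x"
proof (cases "x \<in> {0..1}")
  case True
  have "((\<lambda>x. F i (F j x)) has_real_derivative DF i (F j x) * DF j x) (at x within {0..1})"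
    by (rule has_real_derivative_comp01[where h = "F i" and g = "F j"])
       (auto intro!: DF_works True F_in simp del: atLeastAtMost_iff)
  then show ?thesis
    using D01_eqI[of "F (i + j)" _ x] True by (simp add: F_add[abs_def] DF_def)
next
  case False
  then show ?thesis unfolding F_outside[OF False] by (auto simp: DF_def)
qed

lemma DF_0: "DF 0 x = 1"
proof (cases "x \<in> {0..1}")
  case True
  have "((\<lambda>x. x) has_real_derivative 1) (at x within {0..1})" by (rule DERIV_ident)
  then show ?thesis using D01_eqI[of "F 0" 1 x] True by (simp add: F_def DF_def id_def)
qed (simp only: DF_def if_False)

text \<open>Monotonicity gives only a non-negative derivative; the chain rule with the inverse
  iterate excludes 0.\<close>

lemma DF_pos: "DF j x > 0"
proof (cases "x \<in> {0..1}")
  case True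
  have "((\<lambda>z. (F j z - F j x) / (z - x)) \<longlongrightarrow> DF j x) (at x within {0..1})"
    using DF_works[OF True, of j] by (simp add: has_field_derivative_iff)
  moreover have "(F j z - F j x) / (z - x) \<ge> 0" for z
    using F_less[of z x j] F_less[of x z j] by (cases z x rule: linorder_cases) (auto simp: zero_le_divide_iff)
  moreover have "at x within {0..1} \<noteq> bot"
    using True by (simp add: trivial_limit_within islimpt_Icc)
  ultimately have "DF j x \<ge> 0" by (intro tendsto_lowerbound) auto
  moreover have "DF (- j) (F j x) * DF j x = 1" using DF_add[of "- j" j x] DF_0 by simp
  ultimately show ?thesis by (metis mult_zero_right order_le_less zero_neq_one)
qed (simp only: DF_def if_False zero_less_one)

lemma F_nat: "x \<in> {0..1} \<Longrightarrow> F (int n) x = (f ^^ n) x"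
proof (induction n)
  case (Suc n)
  have "F (int (Suc n)) x = fx (F (int n) x)" using F_Suc[of "int n" x] by (simp add: add.commute)
  then show ?case using Suc F_in[of x "int n"] by (simp add: fx_def)
qed (simp add: F_0)

lemma DF_nat: "x \<in> {0..1} \<Longrightarrow> DF (int n) x = D01 (f ^^ n) x"
  using D01_cong[of "F (int n)" "f ^^ n" x] F_nat by (simp add: DF_def)

lemma DF_1: "x \<in> {0..1} \<Longrightarrow> DF 1 x = D01 f x"
  using DF_nat[of x 1] by simp

lemma interval_action_exists: "\<exists>K C. interval_action F DF K C"
proof -
  define p q r where "p = D01 f" and "q = D01 p" and "r = D01 q"
  have iter: "(D01 ^^ 0) f = f" "(D01 ^^ 1) f = p" "(D01 ^^ 2) f = q" "(D01 ^^ 3) f = r"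
    by (simp_all add: p_def q_def r_def eval_nat_numeral)
  have f: "(f has_real_derivative p t) (at t within {0..1})"
    and p: "(p has_real_derivative q t) (at t within {0..1})"
    and q: "(q has_real_derivative r t) (at t within {0..1})" if "t \<in> {0..1}" for t
    using smooth01_derivative[OF smooth(1) that, of 0] smooth01_derivative[OF smooth(1) that, of 1]
      smooth01_derivative[OF smooth(1) that, of 2]
    by (simp_all add: p_def q_def r_def eval_nat_numeral)
  obtain M0 where M0: "\<And>t. t \<in> {0..1} \<Longrightarrow> \<bar>p t\<bar> \<le> M0"
    using smooth01_bounded[OF smooth(1), of 1] unfolding iter by blast
  obtain M1 where M1: "\<And>t. t \<in> {0..1} \<Longrightarrow> \<bar>q t\<bar> \<le> M1"
    using smooth01_bounded[OF smooth(1), of 2] unfolding iter by blast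
  obtain M2 where M2: "\<And>t. t \<in> {0..1} \<Longrightarrow> \<bar>r t\<bar> \<le> M2"
    using smooth01_bounded[OF smooth(1), of 3] unfolding iter by blast
  have p_eq: "DF 1 t = p t" if "t \<in> {0..1}" for t using DF_1[OF that] by (simp add: p_def)
  have "continuous_on {0..1} p" using smooth01_continuous[OF smooth(1), of 1] unfolding iter .
  then obtain t0 where t0: "t0 \<in> {0..1}" "\<And>t. t \<in> {0..1} \<Longrightarrow> p t0 \<le> p t"
    using continuous_attains_inf[of "{0..1}" p] by auto
  define m where "m = p t0"
  have m: "m > 0" "\<And>t. t \<in> {0..1} \<Longrightarrow> m \<le> p t"
    using t0 DF_pos[of 1 t0] p_eq by (auto simp: m_def)
  have M1_nonneg: "M1 \<ge> 0" using M1[of 0] by simp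
  \<comment> \<open>M0, M1, M2 bound the first three derivatives of f, and m > 0 is the minimum of
    Df. The first constant bounds the derivative q / p of log Df, the second is the one of
    \<open>cross_ratio_kernel_bound\<close>.\<close>
  have "interval_action F DF (M1 / m) ((M1\<^sup>2 / 4 + M0 * M2) / m\<^sup>2)"
  proof
    show "\<bar>ln (DF 1 x) - ln (DF 1 y)\<bar> \<le> M1 / m * \<bar>x - y\<bar>" if xy: "x \<in> {0..1}" "y \<in> {0..1}" for x y
    proof -
      have "norm (ln (p x) - ln (p y)) \<le> (M1 / m) * norm (x - y)"
      proof (rule field_differentiable_bound[where S = "{0..1}" and f' = "\<lambda>t. q t / p t"])
        fix t :: real assume t: "t \<in> {0..1}"
        have "p t > 0" using m t by (meson less_le_trans)
        then show "((\<lambda>t. ln (p t)) has_real_derivative q t / p t) (at t within {0..1})"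
          using p[OF t] by (auto intro!: derivative_eq_intros)
        show "norm (q t / p t) \<le> M1 / m"
          using M1[OF t] m(1) m(2)[OF t] M1_nonneg by (auto simp: abs_divide intro!: frac_le)
      qed (use xy in auto)
      then show ?thesis using xy by (simp add: p_eq)
    qed
    show "\<bar>DF 1 x * DF 1 y / (F 1 x - F 1 y)\<^sup>2 - 1 / (x - y)\<^sup>2\<bar> \<le> (M1\<^sup>2 / 4 + M0 * M2) / m\<^sup>2"
      if xy: "x \<in> {0..1}" "y \<in> {0..1}" "x \<noteq> y" for x y
    proof -
      have "\<bar>q s - q t\<bar> \<le> M2 * \<bar>s - t\<bar>" if "s \<in> {0..1}" "t \<in> {0..1}" for s t
        using field_differentiable_bound[of "{0..1}" q r M2 s t] q M2 that by simp
      then have "\<bar>p x * p y / (f x - f y)\<^sup>2 - 1 / (x - y)\<^sup>2\<bar> \<le> (M1\<^sup>2 / 4 + M0 * M2) / m\<^sup>2"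
        by (intro cross_ratio_kernel_bound[of f p q] f p m M0 M1 xy)
      then show ?thesis using xy F_nat[of _ 1] by (simp add: p_eq)
    qed
    show "DF j x = 1" if "x \<notin> {0..1}" for j x using that by (auto simp: DF_def)
  qed (rule F_0 F_add F_less F_outside DF_works DF_cont DF_pos DF_add; assumption?)+
  then show ?thesis by blast
qed

lemma L_norm_eq:
  assumes "interval_action F DF K C"
  shows "L_norm (f ^^ n) = (\<integral>\<^sup>+p. interval_action.cnorm F DF n p \<partial>(lborel \<Otimes>\<^sub>M lborel))"
proof -
  have "ennreal \<bar>c_kernel (f ^^ n) p\<bar> * indicator ({0..1} \<times> {0..1}) p = interval_action.cnorm F DF n p" for p
    by (cases p) (auto simp: c_kernel_def interval_action.cnorm_def[OF assms] interval_action.k_def[OF assms]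
          F_nat DF_nat F_0 DF_0 indicator_def)
  then show ?thesis by (simp add: L_norm_def lborel_prod)
qed

lemma total_variation_eq:
  assumes "interval_action F DF K C"
  shows "total_variation01 (interval_action.ld DF (int n)) = total_variation01 (\<lambda>x. ln (D01 (f ^^ n) x))"
  by (rule total_variation01_cong) (simp add: interval_action.ld_def[OF assms] DF_nat)

lemma L_norm_tendsto_0:
  assumes "V_infty f = 0"
  shows "(\<lambda>n. L_norm (f ^^ n) / of_nat n) \<longlonglongrightarrow> 0"
proof -
  obtain K C where a: "interval_action F DF K C" using interval_action_exists by blast
  have "(\<lambda>n. total_variation01 (interval_action.ld DF (int n)) / of_nat n) \<longlonglongrightarrow> 0"
    using interval_action.total_variation_ld_convergent[OF a] assms
    unfolding convergent_LIMSEQ_iff V_infty_def total_variation_eq[OF a] by simp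
  with a have "vanishing_variation_action F DF K C"
    by (intro vanishing_variation_action.intro vanishing_variation_action_axioms.intro)
  from vanishing_variation_action.nn_integral_cnorm_tendsto_0[OF this]
  show ?thesis unfolding L_norm_eq[OF a] .
qed

end

theorem mainTheorem6:
  fixes f :: "real \<Rightarrow> real"
  assumes "smooth_diffeo01 f"
    and "V_infty f = 0"
  shows "L_infty f = 0"
  unfolding L_infty_def
  by (intro limI interval_diffeo.L_norm_tendsto_0 interval_diffeo.intro assms)

end
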